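(* Let $\lambda,\mu>0$, assume the grid is regular with constant $C_0$, and suppose the exact solution $\boldsymbol u=(u^x,u^y)$, $\underline\sigma=\begin{pmatrix}\sigma^{11}&\sigma^{12}\\\sigma^{12}&\sigma^{22}\end{pmatrix}$ of the elasticity problem is sufficiently smooth. Let $(W^x,W^y,Z^{11},Z^{22},Z^{12})$ be the solution of the MAC-E scheme with data $f^1_{i,j+1/2}=f^x(x_i,y_{j+1/2})$, $f^2_{i+1/2,j}=f^y(x_{i+1/2},y_j)$. Then, for $h$ and $l$ sufficiently small, there is a constant $C>0$ independent of $h$ and $l$ such that $$\|W^x-\tilde u^x\|_{TM}+\|W^y-\tilde u^y\|_{MT}\le C(h^2+l^2)(\|\boldsymbol u\|_{3,\infty}+\|\underline\sigma\|_{3,\infty}),$$ $$\|Z^{12}-\tilde\sigma^{12}\|_T\le C\mu(h^2+l^2)(\|\boldsymbol u\|_{3,\infty}+\|\underline\sigma\|_{3,\infty}),$$ $$\|Z^{11}-\tilde\sigma^{11}\|_M+\|Z^{22}-\tilde\sigma^{22}\|_M\le C(\lambda+\mu)(h^2+l^2)(\|\boldsymbol u\|_{3,\infty}+\|\underline\sigma\|_{3,\infty}).$$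
   Context: Continuous problem on $\Omega=(0,a)\times(0,b)$ with Lamé constants $\lambda,\mu>0$: $\frac1{2\mu}\big(\sigma^{11}-\frac{\lambda}{2\lambda+2\mu}(\sigma^{11}+\sigma^{22})\big)=\partial_xu^x$, $\frac1{2\mu}\big(\sigma^{22}-\frac{\lambda}{2\lambda+2\mu}(\sigma^{11}+\sigma^{22})\big)=\partial_yu^y$, $\sigma^{12}=\mu(\partial_yu^x+\partial_xu^y)$, $\partial_x\sigma^{11}+\partial_y\sigma^{12}=f^x$, $\partial_x\sigma^{12}+\partial_y\sigma^{22}=f^y$ in $\Omega$, $\boldsymbol u=0$ on $\partial\Omega$. Grid: $0=x_0<\dots<x_{n_x}=a$, $0=y_0<\dots<y_{n_y}=b$, $x_{i+1/2}=(x_i+x_{i+1})/2$, $h_{i+1/2}=x_{i+1}-x_i$, $h_i=(h_{i-1/2}+h_{i+1/2})/2$ ($1\le i\le n_x-1$), $h_0=h_{1/2}/2$, $h_{n_x}=h_{n_x-1/2}/2$, $h=\max h_{i+1/2}$; analogously $y_{j+1/2}$, $l_{j+1/2}$, $l_j$, $l_0=l_{1/2}/2$, $l_{n_y}=l_{n_y-1/2}/2$, $l=\max l_{j+1/2}$. Regularity: $\min_{i,j}\{h_{i+1/2},l_{j+1/2}\}\ge C_0\max_{i,j}\{h_{i+1/2},l_{j+1/2}\}$ for a fixed $C_0>0$. Write $\phi_{\alpha,\beta}=\phi(x_\alpha,y_\beta)$. Difference quotients: $[d_x\phi]_{i+1/2,m}=(\phi_{i+1,m}-\phi_{i,m})/h_{i+1/2}$,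 $[d_y\phi]_{k,j+1/2}=(\phi_{k,j+1}-\phi_{k,j})/l_{j+1/2}$, $[D_x\phi]_{i,m}=(\phi_{i+1/2,m}-\phi_{i-1/2,m})/h_i$ ($1\le i\le n_x-1$), $[D_y\phi]_{k,j}=(\phi_{k,j+1/2}-\phi_{k,j-1/2})/l_j$ ($1\le j\le n_y-1$), $[D_x\phi]_{0,m}=(\phi_{1/2,m}-\phi_{0,m})/h_0$, $[D_x\phi]_{n_x,m}=(\phi_{n_x,m}-\phi_{n_x-1/2,m})/h_{n_x}$, $[D_y\phi]_{k,0}=(\phi_{k,1/2}-\phi_{k,0})/l_0$, $[D_y\phi]_{k,n_y}=(\phi_{k,n_y}-\phi_{k,n_y-1/2})/l_{n_y}$. Inner products: $(\phi,\theta)_M=\sum_{i=0}^{n_x-1}\sum_{j=0}^{n_y-1}h_{i+1/2}l_{j+1/2}\phi_{i+1/2,j+1/2}\theta_{i+1/2,j+1/2}$, $(\phi,\theta)_T=\sum_{i=0}^{n_x}\sum_{j=0}^{n_y}h_il_j\phi_{i,j}\theta_{i,j}$, $(\phi,\theta)_{TM}=\sum_{i=1}^{n_x-1}\sum_{j=0}^{n_y-1}h_il_{j+1/2}\phi_{i,j+1/2}\theta_{i,j+1/2}$, $(\phi,\theta)_{MT}=\sum_{i=0}^{n_x-1}\sum_{j=1}^{n_y-1}h_{i+1/2}l_j\phi_{i+1/2,j}\theta_{i+1/2,j}$, $\|\phi\|_\xi^2=(\phi,\phi)_\xi$. MAC-E scheme: find $W^x$ at $(x_i,y_{j+1/2})$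 ($0\le i\le n_x,0\le j\le n_y-1$) and $(x_i,y_0),(x_i,y_{n_y})$; $W^y$ at $(x_{i+1/2},y_j)$ ($0\le i\le n_x-1,0\le j\le n_y$) and $(x_0,y_j),(x_{n_x},y_j)$; $Z^{11},Z^{22}$ at cell centers $(x_{i+1/2},y_{j+1/2})$; $Z^{12}$ at nodes $(x_i,y_j)$; with $W^x,W^y$ vanishing at all their points on $\partial\Omega$ and: $\frac1{2\mu}\big(Z^{11}-\frac{\lambda}{2\lambda+2\mu}(Z^{11}+Z^{22})\big)_{i+1/2,j+1/2}=[d_xW^x]_{i+1/2,j+1/2}$, $\frac1{2\mu}\big(Z^{22}-\frac{\lambda}{2\lambda+2\mu}(Z^{11}+Z^{22})\big)_{i+1/2,j+1/2}=[d_yW^y]_{i+1/2,j+1/2}$ ($0\le i\le n_x-1,0\le j\le n_y-1$); $Z^{12}_{i,j}=\mu([D_yW^x]_{i,j}+[D_xW^y]_{i,j})$ ($0\le i\le n_x,0\le j\le n_y$); $[D_xZ^{11}]_{i,j+1/2}+[d_yZ^{12}]_{i,j+1/2}=f^1_{i,j+1/2}$ ($1\le i\le n_x-1,0\le j\le n_y-1$); $[d_xZ^{12}]_{i+1/2,j}+[D_yZ^{22}]_{i+1/2,j}=f^2_{i+1/2,j}$ ($0\le i\le n_x-1,1\le j\le n_y-1$). Interpolants: $\tilde\sigma^{kk}_{i+1/2,j+1/2}=\big(\sigma^{kk}-\frac{h_{i+1/2}^2}{8}\partial_x^2\sigma^{kk}-\frac{l_{j+1/2}^2}{8}\partial_y^2\sigma^{kk}\big)_{i+1/2,j+1/2}$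 ($k=1,2$), $\tilde\sigma^{12}_{i,j}=\sigma^{12}_{i,j}$, $\tilde u^x_{i,j+1/2}=\big(u^x-\frac{l_{j+1/2}^2}{8}\partial_y^2u^x\big)_{i,j+1/2}$, $\tilde u^y_{i+1/2,j}=\big(u^y-\frac{h_{i+1/2}^2}{8}\partial_x^2u^y\big)_{i+1/2,j}$. $\|\cdot\|_{3,\infty}$ is the $W^{3,\infty}(\Omega)$ norm, taken componentwise-maximal for vector/tensor fields. *)

theory Defs
  imports "HOL-Analysis.Analysis"
begin

definition pdx :: "(real \<Rightarrow> real \<Rightarrow> real) \<Rightarrow> real \<Rightarrow> real \<Rightarrow> real" where
  "pdx f = (\<lambda>x y. deriv (\<lambda>s. f s y) x)"

definition pdy :: "(real \<Rightarrow> real \<Rightarrow> real) \<Rightarrow> real \<Rightarrow> real \<Rightarrow> real" where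
  "pdy f = (\<lambda>x y. deriv (\<lambda>t. f x t) y)"

fun Ck :: "nat \<Rightarrow> (real \<Rightarrow> real \<Rightarrow> real) \<Rightarrow> bool" where
  "Ck 0 f = continuous_on UNIV (\<lambda>p::real \<times> real. f (fst p) (snd p))"
| "Ck (Suc k) f = (continuous_on UNIV (\<lambda>p::real \<times> real. f (fst p) (snd p))
      \<and> (\<forall>x y. (\<lambda>s. f s y) differentiable (at x) \<and> (\<lambda>t. f x t) differentiable (at y))
      \<and> Ck k (pdx f) \<and> Ck k (pdy f))"

definition norm3inf :: "real \<Rightarrow> real \<Rightarrow> (real \<Rightarrow> real \<Rightarrow> real) \<Rightarrow> real" where
  "norm3inf a b f = Sup {\<bar>((pdy ^^ q) ((pdx ^^ p) f)) x y\<bar> | p q x y.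
       p + q \<le> 3 \<and> 0 < x \<and> x < a \<and> 0 < y \<and> y < b}"

definition is_grid :: "real \<Rightarrow> nat \<Rightarrow> (nat \<Rightarrow> real) \<Rightarrow> bool" where
  "is_grid a n xs = (xs 0 = 0 \<and> xs n = a \<and> (\<forall>i<n. xs i < xs (Suc i)))"

definition hh :: "(nat \<Rightarrow> real) \<Rightarrow> nat \<Rightarrow> real" where
  "hh xs i = xs (Suc i) - xs i"

definition hn :: "(nat \<Rightarrow> real) \<Rightarrow> nat \<Rightarrow> nat \<Rightarrow> real" where
  "hn xs n i = (if i = 0 then hh xs 0 / 2
                else if i = n then hh xs (n - 1) / 2
                else (hh xs (i - 1) + hh xs i) / 2)"

definition hmax :: "(nat \<Rightarrow> real) \<Rightarrow> nat \<Rightarrow> real" where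
  "hmax xs n = Max (hh xs ` {..<n})"

definition hmin :: "(nat \<Rightarrow> real) \<Rightarrow> nat \<Rightarrow> real" where
  "hmin xs n = Min (hh xs ` {..<n})"

definition regular_grid :: "real \<Rightarrow> nat \<Rightarrow> (nat \<Rightarrow> real) \<Rightarrow> nat \<Rightarrow> (nat \<Rightarrow> real) \<Rightarrow> bool" where
  "regular_grid C0 nx xs ny ys =
     (min (hmin xs nx) (hmin ys ny) \<ge> C0 * max (hmax xs nx) (hmax ys ny))"

text \<open>Half-integer indexing: a grid index k :: nat stands for k/2, i.e. 2i ~ i and 2i+1 ~ i+1/2.
  Grid functions are of type nat \<Rightarrow> nat \<Rightarrow> real in these doubled indices.\<close>
definition coord :: "(nat \<Rightarrow> real) \<Rightarrow> nat \<Rightarrow> real" where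
  "coord xs k = (if even k then xs (k div 2) else (xs (k div 2) + xs (Suc (k div 2))) / 2)"

text \<open>[d_x phi]_{i+1/2,m}, m a doubled index\<close>
definition dX :: "(nat \<Rightarrow> real) \<Rightarrow> (nat \<Rightarrow> nat \<Rightarrow> real) \<Rightarrow> nat \<Rightarrow> nat \<Rightarrow> real" where
  "dX xs \<phi> i m = (\<phi> (2*i+2) m - \<phi> (2*i) m) / hh xs i"

text \<open>[d_y phi]_{k,j+1/2}, k a doubled index\<close>
definition dY :: "(nat \<Rightarrow> real) \<Rightarrow> (nat \<Rightarrow> nat \<Rightarrow> real) \<Rightarrow> nat \<Rightarrow> nat \<Rightarrow> real" where
  "dY ys \<phi> k j = (\<phi> k (2*j+2) - \<phi> k (2*j)) / hh ys j"

definition DX :: "(nat \<Rightarrow> real) \<Rightarrow> nat \<Rightarrow> (nat \<Rightarrow> nat \<Rightarrow> real) \<Rightarrow> nat \<Rightarrow> nat \<Rightarrow> real" where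
  "DX xs n \<phi> i m =
     (if i = 0 then (\<phi> 1 m - \<phi> 0 m) / hn xs n 0
      else if i = n then (\<phi> (2*n) m - \<phi> (2*n - 1) m) / hn xs n n
      else (\<phi> (2*i+1) m - \<phi> (2*i - 1) m) / hn xs n i)"

definition DY :: "(nat \<Rightarrow> real) \<Rightarrow> nat \<Rightarrow> (nat \<Rightarrow> nat \<Rightarrow> real) \<Rightarrow> nat \<Rightarrow> nat \<Rightarrow> real" where
  "DY ys n \<phi> k j =
     (if j = 0 then (\<phi> k 1 - \<phi> k 0) / hn ys n 0
      else if j = n then (\<phi> k (2*n) - \<phi> k (2*n - 1)) / hn ys n n
      else (\<phi> k (2*j+1) - \<phi> k (2*j - 1)) / hn ys n j)"

definition normM :: "(nat \<Rightarrow> real) \<Rightarrow> nat \<Rightarrow> (nat \<Rightarrow> real) \<Rightarrow> nat \<Rightarrow> (nat \<Rightarrow> nat \<Rightarrow> real) \<Rightarrow> real" where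
  "normM xs nx ys ny \<phi> =
     sqrt (\<Sum>i<nx. \<Sum>j<ny. hh xs i * hh ys j * (\<phi> (2*i+1) (2*j+1))\<^sup>2)"

definition normT :: "(nat \<Rightarrow> real) \<Rightarrow> nat \<Rightarrow> (nat \<Rightarrow> real) \<Rightarrow> nat \<Rightarrow> (nat \<Rightarrow> nat \<Rightarrow> real) \<Rightarrow> real" where
  "normT xs nx ys ny \<phi> =
     sqrt (\<Sum>i\<le>nx. \<Sum>j\<le>ny. hn xs nx i * hn ys ny j * (\<phi> (2*i) (2*j))\<^sup>2)"

definition normTM :: "(nat \<Rightarrow> real) \<Rightarrow> nat \<Rightarrow> (nat \<Rightarrow> real) \<Rightarrow> nat \<Rightarrow> (nat \<Rightarrow> nat \<Rightarrow> real) \<Rightarrow> real" where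
  "normTM xs nx ys ny \<phi> =
     sqrt (\<Sum>i\<in>{1..<nx}. \<Sum>j<ny. hn xs nx i * hh ys j * (\<phi> (2*i) (2*j+1))\<^sup>2)"

definition normMT :: "(nat \<Rightarrow> real) \<Rightarrow> nat \<Rightarrow> (nat \<Rightarrow> real) \<Rightarrow> nat \<Rightarrow> (nat \<Rightarrow> nat \<Rightarrow> real) \<Rightarrow> real" where
  "normMT xs nx ys ny \<phi> =
     sqrt (\<Sum>i<nx. \<Sum>j\<in>{1..<ny}. hh xs i * hn ys ny j * (\<phi> (2*i+1) (2*j))\<^sup>2)"

definition elasticity_solution ::
  "real \<Rightarrow> real \<Rightarrow> real \<Rightarrow> real \<Rightarrow> (real \<Rightarrow> real \<Rightarrow> real) \<Rightarrow> (real \<Rightarrow> real \<Rightarrow> real) \<Rightarrow>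
   (real \<Rightarrow> real \<Rightarrow> real) \<Rightarrow> (real \<Rightarrow> real \<Rightarrow> real) \<Rightarrow> (real \<Rightarrow> real \<Rightarrow> real) \<Rightarrow>
   (real \<Rightarrow> real \<Rightarrow> real) \<Rightarrow> (real \<Rightarrow> real \<Rightarrow> real) \<Rightarrow> bool" where
  "elasticity_solution a b lam mu ux uy s11 s12 s22 fx fy =
    ((\<forall>x y. 0 < x \<and> x < a \<and> 0 < y \<and> y < b \<longrightarrow>
        1 / (2*mu) * (s11 x y - lam / (2*lam + 2*mu) * (s11 x y + s22 x y)) = pdx ux x y
      \<and> 1 / (2*mu) * (s22 x y - lam / (2*lam + 2*mu) * (s11 x y + s22 x y)) = pdy uy x y
      \<and> s12 x y = mu * (pdy ux x y + pdx uy x y)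
      \<and> pdx s11 x y + pdy s12 x y = fx x y
      \<and> pdx s12 x y + pdy s22 x y = fy x y)
    \<and> (\<forall>x y. 0 \<le> x \<and> x \<le> a \<and> 0 \<le> y \<and> y \<le> b \<and> (x = 0 \<or> x = a \<or> y = 0 \<or> y = b) \<longrightarrow>
        ux x y = 0 \<and> uy x y = 0))"

text \<open>Wx lives at (2i, 2j+1) and (2i, 0), (2i, 2ny); Wy at (2i+1, 2j) and (0, 2j), (2nx, 2j);
  Z11, Z22 at (2i+1, 2j+1); Z12 at (2i, 2j).\<close>
definition MACE_solution ::
  "real \<Rightarrow> real \<Rightarrow> nat \<Rightarrow> (nat \<Rightarrow> real) \<Rightarrow> nat \<Rightarrow> (nat \<Rightarrow> real) \<Rightarrow>
   (real \<Rightarrow> real \<Rightarrow> real) \<Rightarrow> (real \<Rightarrow> real \<Rightarrow> real) \<Rightarrow>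
   (nat \<Rightarrow> nat \<Rightarrow> real) \<Rightarrow> (nat \<Rightarrow> nat \<Rightarrow> real) \<Rightarrow> (nat \<Rightarrow> nat \<Rightarrow> real) \<Rightarrow>
   (nat \<Rightarrow> nat \<Rightarrow> real) \<Rightarrow> (nat \<Rightarrow> nat \<Rightarrow> real) \<Rightarrow> bool" where
  "MACE_solution lam mu nx xs ny ys fx fy Wx Wy Z11 Z22 Z12 =
    ((\<forall>j<ny. Wx 0 (2*j+1) = 0 \<and> Wx (2*nx) (2*j+1) = 0)
   \<and> (\<forall>i\<le>nx. Wx (2*i) 0 = 0 \<and> Wx (2*i) (2*ny) = 0)
   \<and> (\<forall>i<nx. Wy (2*i+1) 0 = 0 \<and> Wy (2*i+1) (2*ny) = 0)
   \<and> (\<forall>j\<le>ny. Wy 0 (2*j) = 0 \<and> Wy (2*nx) (2*j) = 0)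
   \<and> (\<forall>i<nx. \<forall>j<ny.
        1 / (2*mu) * (Z11 (2*i+1) (2*j+1) - lam / (2*lam + 2*mu) * (Z11 (2*i+1) (2*j+1) + Z22 (2*i+1) (2*j+1)))
          = dX xs Wx i (2*j+1)
      \<and> 1 / (2*mu) * (Z22 (2*i+1) (2*j+1) - lam / (2*lam + 2*mu) * (Z11 (2*i+1) (2*j+1) + Z22 (2*i+1) (2*j+1)))
          = dY ys Wy (2*i+1) j)
   \<and> (\<forall>i\<le>nx. \<forall>j\<le>ny. Z12 (2*i) (2*j) = mu * (DY ys ny Wx (2*i) j + DX xs nx Wy i (2*j)))
   \<and> (\<forall>i. 1 \<le> i \<and> i < nx \<longrightarrow> (\<forall>j<ny.
        DX xs nx Z11 i (2*j+1) + dY ys Z12 (2*i) j = fx (xs i) (coord ys (2*j+1))))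
   \<and> (\<forall>i<nx. \<forall>j. 1 \<le> j \<and> j < ny \<longrightarrow>
        dX xs Z12 i (2*j) + DY ys ny Z22 (2*i+1) j = fy (coord xs (2*i+1)) (ys j)))"

section \<open>Interpolants (as doubled-index grid functions, relevant only at their points)\<close>

definition tsig_diag :: "(nat \<Rightarrow> real) \<Rightarrow> (nat \<Rightarrow> real) \<Rightarrow> (real \<Rightarrow> real \<Rightarrow> real) \<Rightarrow> nat \<Rightarrow> nat \<Rightarrow> real" where
  "tsig_diag xs ys s k m =
     (let X = coord xs k; Y = coord ys m in
      s X Y - (hh xs (k div 2))\<^sup>2 / 8 * pdx (pdx s) X Y - (hh ys (m div 2))\<^sup>2 / 8 * pdy (pdy s) X Y)"

definition tsig_off :: "(nat \<Rightarrow> real) \<Rightarrow> (nat \<Rightarrow> real) \<Rightarrow> (real \<Rightarrow> real \<Rightarrow> real) \<Rightarrow> nat \<Rightarrow> nat \<Rightarrow> real" where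
  "tsig_off xs ys s k m = s (coord xs k) (coord ys m)"

definition tux :: "(nat \<Rightarrow> real) \<Rightarrow> (nat \<Rightarrow> real) \<Rightarrow> (real \<Rightarrow> real \<Rightarrow> real) \<Rightarrow> nat \<Rightarrow> nat \<Rightarrow> real" where
  "tux xs ys u k m =
     (let X = coord xs k; Y = coord ys m in u X Y - (hh ys (m div 2))\<^sup>2 / 8 * pdy (pdy u) X Y)"

definition tuy :: "(nat \<Rightarrow> real) \<Rightarrow> (nat \<Rightarrow> real) \<Rightarrow> (real \<Rightarrow> real \<Rightarrow> real) \<Rightarrow> nat \<Rightarrow> nat \<Rightarrow> real" where
  "tuy xs ys u k m =
     (let X = coord xs k; Y = coord ys m in u X Y - (hh xs (k div 2))\<^sup>2 / 8 * pdx (pdx u) X Y)"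

end

theory Submission
  imports Defs
begin

text \<open>The corrections in the interpolants cancel the first-order truncation errors caused by the
  non-uniform grid, so that inserting the interpolants into the scheme leaves pointwise residuals of
  size \<open>O(h\<^sup>2 + l\<^sup>2)\<close> in all five equations, up to the boundary. Testing the momentum residuals with the
  displacement error and summing by parts bounds the stress error in the compliance norm; the
  displacement error vanishes on the sides, so its diagonal difference quotients, which the stress error
  controls, bound it by a one-dimensional Poincare inequality, without a discrete Korn inequality.\<close>

section \<open>Smooth functions of two variables\<close>

text \<open>On a non-uniform grid a node is not the midpoint of its two neighbouring cell centres,
  so a centre-to-centre quotient of exact values is only first order accurate at the node; a
  node-to-node quotient is centred and stays second order. Each interpolant therefore carries a
  correction in the direction in which the scheme differences it between centres: y for
  \<open>tux\<close>, x for \<open>tuy\<close>, x for the first and y for the second normal stress.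
  The shear stress is differenced only between nodes and carries none. A correction in the
  transverse direction has the same factor at both points of a quotient, so it contributes that
  factor times a mixed third derivative, again of second order. In the energy argument the stress
  error is bounded through the displacement error, and the displacement error through the stress
  error. The circle is closed by giving the momentum residuals a small Young weight and absorbing
  the result. Most estimates are proved for one coordinate direction only; swapping the arguments of
  functions and of grid functions yields the other one.\<close>

lemma pdx_transpose: "pdx (\<lambda>x y. f y x) = (\<lambda>x y. pdy f y x)"
  and pdy_transpose: "pdy (\<lambda>x y. f y x) = (\<lambda>x y. pdx f y x)"
  by (simp_all add: pdx_def pdy_def)

lemma continuous_swap_args:
  assumes "continuous_on UNIV (\<lambda>p::real \<times> real. f (fst p) (snd p) :: real)"
  shows "continuous_on UNIV (\<lambda>p::real \<times> real. f (snd p) (fst p))"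
proof -
  have "continuous_on UNIV (prod.swap :: real \<times> real \<Rightarrow> real \<times> real)"
    by (rule continuous_on_swap)
  from continuous_on_compose2[OF assms this] show ?thesis by simp
qed

lemma Ck_transpose: "Ck k f \<Longrightarrow> Ck k (\<lambda>x y. f y x)"
proof (induction k arbitrary: f)
  case 0
  then show ?case using continuous_swap_args[of f] by simp
next
  case (Suc k)
  show ?case
    using Suc.prems continuous_swap_args[of f] Suc.IH[of "pdx f"] Suc.IH[of "pdy f"]
    by (simp add: pdx_transpose[of f] pdy_transpose[of f])
qed

lemma Ck_SucD: "Ck (Suc k) f \<Longrightarrow> Ck k f"
proof (induction k arbitrary: f)
  case (Suc k)
  show ?case
    using Suc.prems Suc.IH[of "pdx f"] Suc.IH[of "pdy f"] unfolding Ck.simps(2)[of _ f] by blast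
qed simp

lemma Ck_mono: "m \<le> k \<Longrightarrow> Ck k f \<Longrightarrow> Ck m f"
  by (induction rule: inc_induct) (auto dest: Ck_SucD simp del: Ck.simps)

lemma Ck_pdx: "Ck (Suc k) f \<Longrightarrow> Ck k (pdx f)"
  and Ck_pdy: "Ck (Suc k) f \<Longrightarrow> Ck k (pdy f)"
  by auto

lemma Ck_DERIV_x: "Ck (Suc k) f \<Longrightarrow> ((\<lambda>s. f s y) has_real_derivative pdx f x y) (at x)"
  and Ck_DERIV_y: "Ck (Suc k) f \<Longrightarrow> ((\<lambda>t. f x t) has_real_derivative pdy f x y) (at y)"
  by (auto simp: pdx_def pdy_def DERIV_deriv_iff_real_differentiable)

lemma Ck_funpow_pdx: "Ck (k + p) f \<Longrightarrow> Ck k ((pdx ^^ p) f)"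
  by (induction p arbitrary: k) (auto simp del: Ck.simps simp: Ck_pdx)

lemma Ck_funpow_pdy: "Ck (k + p) f \<Longrightarrow> Ck k ((pdy ^^ p) f)"
  by (induction p arbitrary: k) (auto simp del: Ck.simps simp: Ck_pdy)

section \<open>Symmetry of mixed partial derivatives\<close>

lemma second_difference_mvt:
  assumes f: "Ck 2 f" and t: "t > 0"
  shows "\<exists>\<xi> \<eta>. x < \<xi> \<and> \<xi> < x + t \<and> y < \<eta> \<and> \<eta> < y + t \<and>
    f (x + t) (y + t) - f (x + t) y - f x (y + t) + f x y = t\<^sup>2 * pdy (pdx f) \<xi> \<eta>"
proof -
  have f1: "Ck (Suc 1) f" using f by (simp add: numeral_2_eq_2)
  have fx: "Ck (Suc 0) (pdx f)" using Ck_pdx[OF f1] by simp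
  have "\<And>s. ((\<lambda>s. f s (y + t) - f s y) has_real_derivative (pdx f s (y + t) - pdx f s y)) (at s)"
    by (intro derivative_intros Ck_DERIV_x[OF f1])
  then obtain \<xi> where \<xi>: "x < \<xi>" "\<xi> < x + t"
    "(f (x + t) (y + t) - f (x + t) y) - (f x (y + t) - f x y)
       = (x + t - x) * (pdx f \<xi> (y + t) - pdx f \<xi> y)"
    using MVT2[of x "x + t" "\<lambda>s. f s (y + t) - f s y" "\<lambda>s. pdx f s (y + t) - pdx f s y"] t by auto
  obtain \<eta> where \<eta>: "y < \<eta>" "\<eta> < y + t"
    "pdx f \<xi> (y + t) - pdx f \<xi> y = (y + t - y) * pdy (pdx f) \<xi> \<eta>"
    using MVT2[of y "y + t" "pdx f \<xi>" "\<lambda>\<eta>. pdy (pdx f) \<xi> \<eta>"] t Ck_DERIV_y[OF fx] by auto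
  show ?thesis
    using \<xi> \<eta> by (intro exI[of _ \<xi>] exI[of _ \<eta>]) (auto simp: power2_eq_square algebra_simps)
qed

text \<open>The second difference over a small square can be reduced by mean values in either order
  of the variables, so it equals the area times either mixed derivative at nearby points; continuity
  does the rest. This is needed because \<open>norm3inf\<close> samples derivatives only with the
  x-derivatives taken first.\<close>

lemma Clairaut:
  assumes f: "Ck 2 f"
  shows "pdx (pdy f) = pdy (pdx f)"
proof (intro ext)
  fix x y
  let ?G = "pdy (pdx f)" and ?H = "pdx (pdy f)"
  have f1: "Ck (Suc (Suc 0)) f" using f by (simp add: numeral_2_eq_2)
  have G: "continuous_on UNIV (\<lambda>p::real \<times> real. ?G (fst p) (snd p))"
    and H: "continuous_on UNIV (\<lambda>p::real \<times> real. ?H (fst p) (snd p))"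
    using f1 by auto
  have "\<bar>?H x y - ?G x y\<bar> \<le> e" if "e > 0" for e
  proof -
    obtain d1 where d1: "d1 > 0" "\<And>p. dist p (x, y) < d1 \<Longrightarrow> dist (?G (fst p) (snd p)) (?G x y) < e / 2"
      using G[unfolded continuous_on_iff, rule_format, of "(x, y)" "e / 2"] \<open>e > 0\<close> by auto
    obtain d2 where d2: "d2 > 0" "\<And>p. dist p (x, y) < d2 \<Longrightarrow> dist (?H (fst p) (snd p)) (?H x y) < e / 2"
      using H[unfolded continuous_on_iff, rule_format, of "(x, y)" "e / 2"] \<open>e > 0\<close> by auto
    define t where "t = min d1 d2 / 2"
    have t: "t > 0" "2 * t \<le> d1" "2 * t \<le> d2" using d1(1) d2(1) by (auto simp: t_def)
    have near: "dist (\<xi>, \<eta>) (x, y) < 2 * t"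
      if "x < \<xi>" "\<xi> < x + t" "y < \<eta>" "\<eta> < y + t" for \<xi> \<eta>
    proof -
      have "dist (\<xi>, \<eta>) (x, y) \<le> dist \<xi> x + dist \<eta> y"
        unfolding dist_prod_def by (simp add: sqrt_sum_squares_le_sum)
      also have "\<dots> < 2 * t" using that by (auto simp: dist_real_def)
      finally show ?thesis .
    qed
    obtain \<xi> \<eta> where 1: "x < \<xi>" "\<xi> < x + t" "y < \<eta>" "\<eta> < y + t"
      "f (x + t) (y + t) - f (x + t) y - f x (y + t) + f x y = t\<^sup>2 * ?G \<xi> \<eta>"
      using second_difference_mvt[OF f t(1)] by blast
    \<comment> \<open>The same second difference, read for the function with swapped
      arguments.\<close>
    obtain \<eta>' \<xi>' where 2: "x < \<xi>'" "\<xi>' < x + t" "y < \<eta>'" "\<eta>' < y + t"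
      "f (x + t) (y + t) - f x (y + t) - f (x + t) y + f x y = t\<^sup>2 * ?H \<xi>' \<eta>'"
      using second_difference_mvt[OF Ck_transpose[OF f] t(1), of y x]
      unfolding pdx_transpose[of f] pdy_transpose[of "pdy f"] by blast
    have "t\<^sup>2 * ?G \<xi> \<eta> = t\<^sup>2 * ?H \<xi>' \<eta>'" using 1(5) 2(5) by linarith
    then have eq: "?G \<xi> \<eta> = ?H \<xi>' \<eta>'" using t by simp
    have "dist (?G \<xi> \<eta>) (?G x y) < e / 2" using d1(2)[of "(\<xi>, \<eta>)"] near[OF 1(1-4)] t by simp
    moreover have "dist (?H \<xi>' \<eta>') (?H x y) < e / 2" using d2(2)[of "(\<xi>', \<eta>')"] near[OF 2(1-4)] t by simp
    ultimately show ?thesis unfolding eq dist_real_def by linarith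
  qed
  then have "\<bar>?H x y - ?G x y\<bar> \<le> 0" by (rule field_le_epsilon[OF _, of _ 0, simplified])
  then show "?H x y = ?G x y" by simp
qed

section \<open>Derivative bounds up to the boundary of the rectangle\<close>

lemma closed_rectangle_extend:
  assumes g: "continuous_on UNIV (\<lambda>p::real \<times> real. g (fst p) (snd p) :: real)"
    and a: "a > 0" "b > 0"
    and le: "\<And>x y. 0 < x \<Longrightarrow> x < a \<Longrightarrow> 0 < y \<Longrightarrow> y < b \<Longrightarrow> g x y \<le> K"
    and xy: "0 \<le> x" "x \<le> a" "0 \<le> y" "y \<le> b"
  shows "g x y \<le> K"
proof -
  let ?S = "{p::real \<times> real. g (fst p) (snd p) \<le> K}"
  have "closed ?S" by (rule closed_Collect_le[OF g continuous_on_const])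
  moreover have "{0<..<a} \<times> {0<..<b} \<subseteq> ?S" using le by auto
  ultimately have "closure ({0<..<a} \<times> {0<..<b}) \<subseteq> ?S" by (rule closure_minimal[rotated])
  moreover have "(x, y) \<in> closure ({0<..<a} \<times> {0<..<b})" using a xy by (simp add: closure_Times)
  ultimately show ?thesis by auto
qed

text \<open>These are the derivatives that enter the truncation errors: pure third ones in the
  Taylor remainders, second ones in the size of a correction, mixed third ones in a transverse
  quotient of a correction. The list is closed under swapping the variables.\<close>

definition deriv_bound :: "real \<Rightarrow> real \<Rightarrow> real \<Rightarrow> (real \<Rightarrow> real \<Rightarrow> real) \<Rightarrow> bool" where
  "deriv_bound a b K f \<longleftrightarrow> Ck 3 f \<and>
    (\<forall>x\<in>{0..a}. \<forall>y\<in>{0..b}. \<bar>pdx (pdx f) x y\<bar> \<le> K \<and> \<bar>pdy (pdy f) x y\<bar> \<le> K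
      \<and> \<bar>pdx (pdx (pdx f)) x y\<bar> \<le> K \<and> \<bar>pdy (pdy (pdy f)) x y\<bar> \<le> K
      \<and> \<bar>pdx (pdy (pdy f)) x y\<bar> \<le> K \<and> \<bar>pdy (pdx (pdx f)) x y\<bar> \<le> K)"

lemma deriv_bound_transpose: "deriv_bound a b K f \<Longrightarrow> deriv_bound b a K (\<lambda>x y. f y x)"
  unfolding deriv_bound_def pdx_transpose[of f] pdy_transpose[of f]
    pdx_transpose[of "pdx f"] pdx_transpose[of "pdy f"] pdy_transpose[of "pdx f"] pdy_transpose[of "pdy f"]
    pdx_transpose[of "pdx (pdx f)"] pdx_transpose[of "pdy (pdy f)"]
    pdy_transpose[of "pdx (pdx f)"] pdy_transpose[of "pdy (pdy f)"]
  using Ck_transpose[of 3 f] by blast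

lemma deriv_bound_mono: "deriv_bound a b K f \<Longrightarrow> K \<le> L \<Longrightarrow> deriv_bound a b L f"
proof -
  assume *: "K \<le> L" "deriv_bound a b K f"
  then have "\<bar>z\<bar> \<le> K \<Longrightarrow> \<bar>z\<bar> \<le> L" for z by linarith
  with *(2) show ?thesis unfolding deriv_bound_def by blast
qed

text \<open>A real \<open>Sup\<close> bounds its elements only when the set is bounded above. Here
  this follows from compactness of the closed rectangle and the finiteness of the admissible pairs
  of orders. The supremum runs over the open rectangle, so grid points on the sides are reached by
  continuity.\<close>

lemma norm3inf_bound:
  assumes f: "Ck 3 f" and a: "a > 0" "b > 0" and pq: "p + q \<le> 3"
    and xy: "0 \<le> x" "x \<le> a" "0 \<le> y" "y \<le> b"
  shows "\<bar>((pdy ^^ q) ((pdx ^^ p) f)) x y\<bar> \<le> norm3inf a b f"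
proof -
  let ?D = "\<lambda>p q x y. \<bar>((pdy ^^ q) ((pdx ^^ p) f)) x y\<bar>"
  let ?S = "{?D p q x y | p q x y. p + q \<le> 3 \<and> 0 < x \<and> x < a \<and> 0 < y \<and> y < b}"
  have cont: "continuous_on UNIV (\<lambda>z::real \<times> real. ?D p q (fst z) (snd z))" if "p + q \<le> 3" for p q
  proof -
    have "Ck (0 + q + p) f" using Ck_mono[OF _ f] that by simp
    then have "Ck 0 ((pdy ^^ q) ((pdx ^^ p) f))" by (intro Ck_funpow_pdx Ck_funpow_pdy)
    then show ?thesis using continuous_on_rabs by fastforce
  qed
  have "bdd_above ?S"
  proof -
    let ?I = "{pq::nat \<times> nat. fst pq + snd pq \<le> 3}"
    let ?T = "\<Union>pq\<in>?I. (\<lambda>z. ?D (fst pq) (snd pq) (fst z) (snd z)) ` ({0..a} \<times> {0..b})"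
    have "?I \<subseteq> {..3} \<times> {..3}" by auto
    then have "finite ?I" by (rule finite_subset) simp
    moreover have "bounded ((\<lambda>z. ?D (fst pq) (snd pq) (fst z) (snd z)) ` ({0..a} \<times> {0..b}))"
      if "pq \<in> ?I" for pq
      using that by (intro compact_imp_bounded compact_continuous_image compact_Times compact_Icc
          continuous_on_subset[OF cont]) auto
    ultimately have "bounded ?T" by (intro bounded_UN) auto
    then have "bdd_above ?T" by (rule bounded_imp_bdd_above)
    then show ?thesis
    proof (rule bdd_above_mono)
      show "?S \<subseteq> ?T"
        apply clarsimp
        subgoal for p q x y by (rule exI[of _ p], rule exI[of _ q]) force
        done
    qed
  qed
  then have "?D p q x y \<le> Sup ?S" if "0 < x" "x < a" "0 < y" "y < b" for x y
    using that pq by (intro cSup_upper) auto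
  then show ?thesis
    using closed_rectangle_extend[OF cont[OF pq] a _ xy] unfolding norm3inf_def by blast
qed

lemma deriv_bound_norm3inf:
  assumes f: "Ck 3 f" and a: "a > 0" "b > 0"
  shows "deriv_bound a b (norm3inf a b f) f"
proof -
  have 2: "Ck 2 f" and 3: "Ck 2 (pdy f)"
    using Ck_mono[OF _ f, of 2] Ck_pdy[of 2 f] f by (simp_all add: eval_nat_numeral del: Ck.simps)
  \<comment> \<open>The x-derivative is moved inwards past both y-derivatives, giving the order
    sampled by \<open>norm3inf\<close>.\<close>
  have "pdx (pdy (pdy f)) = pdy (pdy (pdx f))"
    by (simp add: Clairaut[OF 2] Clairaut[OF 3])
  then have "\<bar>pdx (pdx f) x y\<bar> \<le> norm3inf a b f \<and> \<bar>pdy (pdy f) x y\<bar> \<le> norm3inf a b f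
      \<and> \<bar>pdx (pdx (pdx f)) x y\<bar> \<le> norm3inf a b f \<and> \<bar>pdy (pdy (pdy f)) x y\<bar> \<le> norm3inf a b f
      \<and> \<bar>pdx (pdy (pdy f)) x y\<bar> \<le> norm3inf a b f \<and> \<bar>pdy (pdx (pdx f)) x y\<bar> \<le> norm3inf a b f"
    if "x \<in> {0..a}" "y \<in> {0..b}" for x y
    using that norm3inf_bound[OF f a, of 2 0 x y] norm3inf_bound[OF f a, of 0 2 x y]
      norm3inf_bound[OF f a, of 3 0 x y] norm3inf_bound[OF f a, of 0 3 x y]
      norm3inf_bound[OF f a, of 1 2 x y] norm3inf_bound[OF f a, of 2 1 x y]
    by (simp add: eval_nat_numeral)
  then show ?thesis unfolding deriv_bound_def using f by blast
qed

lemma norm3inf_nonneg: "Ck 3 f \<Longrightarrow> a > 0 \<Longrightarrow> b > 0 \<Longrightarrow> norm3inf a b f \<ge> 0"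
  using norm3inf_bound[of f a b 0 0 0 0] by simp

text \<open>The correction \<open>t\<^sup>2/2 \<phi>''\<close> cancels the second-order Taylor term, so an increment over a
  half cell reproduces \<open>t \<phi>'\<close> to third order even on non-uniform grids.\<close>

lemma corrected_increment:
  fixes \<phi> \<phi>1 \<phi>2 \<phi>3 :: "real \<Rightarrow> real"
  assumes D: "\<And>z. (\<phi> has_real_derivative \<phi>1 z) (at z)" "\<And>z. (\<phi>1 has_real_derivative \<phi>2 z) (at z)"
      "\<And>z. (\<phi>2 has_real_derivative \<phi>3 z) (at z)"
    and K: "\<forall>z\<in>{0..L}. \<bar>\<phi>3 z\<bar> \<le> K"
    and p: "p \<in> {0..L}" and q: "q \<in> {0..L}"
  shows "\<bar>\<phi> q - (q - p)\<^sup>2 / 2 * \<phi>2 q - \<phi> p - (q - p) * \<phi>1 p\<bar> \<le> K * \<bar>q - p\<bar> ^ 3"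
proof (cases "p = q")
  case False
  define F where "F = (\<lambda>m::nat. if m = 0 then \<phi> else if m = 1 then \<phi>1 else if m = 2 then \<phi>2 else \<phi>3)"
  have F: "(F m has_real_derivative F (Suc m) z) (at z)" if "m < 3" for m z
  proof -
    consider "m = 0" | "m = 1" | "m = 2" using \<open>m < 3\<close> by linarith
    then show ?thesis by cases (simp_all add: F_def D)
  qed
  have F0: "F 0 = \<phi>" "F (Suc 0) = \<phi>1" by (simp_all add: F_def)
  obtain \<xi> where \<xi>: "if p < q then p < \<xi> \<and> \<xi> < q else q < \<xi> \<and> \<xi> < p"
    "\<phi> p = (\<Sum>m<3. F m q / fact m * (p - q) ^ m) + F 3 \<xi> / fact 3 * (p - q) ^ 3"
    using Taylor[of 3 F \<phi> 0 L q p] F p q False by (auto simp: F0)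
  obtain \<zeta> where \<zeta>: "if p < q then p < \<zeta> \<and> \<zeta> < q else q < \<zeta> \<and> \<zeta> < p"
    "\<phi>1 p = (\<Sum>m<2. F (Suc m) q / fact m * (p - q) ^ m) + F (Suc 2) \<zeta> / fact 2 * (p - q) ^ 2"
    using Taylor[of 2 "\<lambda>m. F (Suc m)" \<phi>1 0 L q p] F p q False by (auto simp: F0)
  \<comment> \<open>Both Taylor expansions are about \<open>q\<close>, where the correction is
    evaluated. Eliminating the first derivative at \<open>q\<close> leaves exactly the subtracted
    second-order term.\<close>
  have e1: "\<phi> p = \<phi> q - (q - p) * \<phi>1 q + (q - p)\<^sup>2 / 2 * \<phi>2 q - \<phi>3 \<xi> / 6 * (q - p) ^ 3"
    using \<xi>(2) by (simp add: F_def numeral_3_eq_3 fact_numeral) (simp add: field_simps power2_eq_square power3_eq_cube)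
  have e2: "\<phi>1 p = \<phi>1 q - (q - p) * \<phi>2 q + \<phi>3 \<zeta> / 2 * (q - p)\<^sup>2"
    using \<zeta>(2) by (simp add: F_def numeral_2_eq_2) (simp add: field_simps power2_eq_square)
  have eq: "\<phi> q - (q - p)\<^sup>2 / 2 * \<phi>2 q - \<phi> p - (q - p) * \<phi>1 p = (\<phi>3 \<xi> / 6 - \<phi>3 \<zeta> / 2) * (q - p) ^ 3"
    unfolding e1 e2 by (simp add: field_simps power2_eq_square power3_eq_cube)
  have "\<bar>\<phi>3 \<xi>\<bar> \<le> K" "\<bar>\<phi>3 \<zeta>\<bar> \<le> K"
    using \<xi>(1) \<zeta>(1) p q by (auto intro!: bspec[OF K] split: if_splits)
  \<comment> \<open>Since 1/6 + 1/2 < 1, the bound \<open>K\<close> needs no extra factor.\<close>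
  then have "\<bar>\<phi>3 \<xi> / 6 - \<phi>3 \<zeta> / 2\<bar> \<le> K" by linarith
  then show ?thesis unfolding eq abs_mult power_abs by (intro mult_right_mono) auto
qed simp

section \<open>Consistency\<close>

text \<open>Passing through \<open>p\<close> splits the difference into two corrected increments of
  lengths \<open>r\<close> and \<open>s\<close>. The value at \<open>p\<close> cancels and the
  linear terms add up to \<open>r + s\<close> times the derivative. One length may be zero: its
  correction then disappears, which covers the half-cell quotients with an uncorrected boundary
  value.\<close>

lemma corrected_quotient:
  fixes \<phi> \<phi>1 \<phi>2 \<phi>3 :: "real \<Rightarrow> real"
  assumes D: "\<And>z. (\<phi> has_real_derivative \<phi>1 z) (at z)" "\<And>z. (\<phi>1 has_real_derivative \<phi>2 z) (at z)"
      "\<And>z. (\<phi>2 has_real_derivative \<phi>3 z) (at z)"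
    and K: "\<forall>z\<in>{0..L}. \<bar>\<phi>3 z\<bar> \<le> K"
    and rs: "0 \<le> r" "0 \<le> s" "0 < r + s" "r \<le> H" "s \<le> H" and L: "0 \<le> p - s" "p + r \<le> L"
  shows "\<bar>((\<phi> (p + r) - r\<^sup>2 / 2 * \<phi>2 (p + r)) - (\<phi> (p - s) - s\<^sup>2 / 2 * \<phi>2 (p - s))) / (r + s) - \<phi>1 p\<bar>
    \<le> K * H\<^sup>2"
proof -
  have p: "p \<in> {0..L}" "p + r \<in> {0..L}" "p - s \<in> {0..L}" using rs L by auto
  have K0: "K \<ge> 0" using bspec[OF K p(1)] by linarith
  note ci = corrected_increment[OF D K p(1)]
  have cube: "K * t ^ 3 \<le> K * H\<^sup>2 * t" if "0 \<le> t" "t \<le> H" for t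
  proof -
    have "t ^ 3 = t\<^sup>2 * t" by (simp add: power2_eq_square power3_eq_cube)
    also have "\<dots> \<le> H\<^sup>2 * t" using that by (intro mult_right_mono power_mono) auto
    finally show ?thesis using K0 by (simp add: mult_left_mono mult.assoc)
  qed
  have 1: "\<bar>\<phi> (p + r) - r\<^sup>2 / 2 * \<phi>2 (p + r) - \<phi> p - r * \<phi>1 p\<bar> \<le> K * H\<^sup>2 * r"
    using ci[OF p(2)] cube[OF rs(1,4)] rs(1) by simp
  have 2: "\<bar>\<phi> (p - s) - s\<^sup>2 / 2 * \<phi>2 (p - s) - \<phi> p + s * \<phi>1 p\<bar> \<le> K * H\<^sup>2 * s"
    using ci[OF p(3)] cube[OF rs(2,5)] rs(2) by simp
  let ?N = "(\<phi> (p + r) - r\<^sup>2 / 2 * \<phi>2 (p + r)) - (\<phi> (p - s) - s\<^sup>2 / 2 * \<phi>2 (p - s))"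
  have "\<bar>?N - (r + s) * \<phi>1 p\<bar> \<le> K * H\<^sup>2 * r + K * H\<^sup>2 * s"
    using 1 2 unfolding distrib_right by linarith
  then have "\<bar>?N - (r + s) * \<phi>1 p\<bar> \<le> (K * H\<^sup>2) * (r + s)" by (simp add: distrib_left)
  moreover have "?N / (r + s) - \<phi>1 p = (?N - (r + s) * \<phi>1 p) / (r + s)" using rs(3) by (simp add: diff_divide_distrib)
  ultimately show ?thesis using rs(3) by (simp add: abs_divide pos_divide_le_eq)
qed

lemma Lipschitz_quotient:
  fixes \<psi> \<psi>1 :: "real \<Rightarrow> real"
  assumes D: "\<And>z. (\<psi> has_real_derivative \<psi>1 z) (at z)" and K: "\<forall>z\<in>{0..L}. \<bar>\<psi>1 z\<bar> \<le> K"
    and pq: "0 \<le> p" "p < q" "q \<le> L"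
  shows "\<bar>(\<psi> q - \<psi> p) / (q - p)\<bar> \<le> K"
proof -
  obtain z where "p < z" "z < q" "\<psi> q - \<psi> p = (q - p) * \<psi>1 z"
    using MVT2[of p q \<psi> \<psi>1] pq D by auto
  then show ?thesis using bspec[OF K, of z] pq by auto
qed

text \<open>With equal half lengths the two corrections have the same factor, so removing them costs
  this factor times a difference quotient of the second derivative, which is of second order.
  Centred quotients thus work on uncorrected values.\<close>

lemma central_quotient:
  fixes \<phi> \<phi>1 \<phi>2 \<phi>3 :: "real \<Rightarrow> real"
  assumes D: "\<And>z. (\<phi> has_real_derivative \<phi>1 z) (at z)" "\<And>z. (\<phi>1 has_real_derivative \<phi>2 z) (at z)"
      "\<And>z. (\<phi>2 has_real_derivative \<phi>3 z) (at z)"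
    and K: "\<forall>z\<in>{0..L}. \<bar>\<phi>3 z\<bar> \<le> K"
    and pq: "0 \<le> p" "p < q" "q \<le> L" "q - p \<le> H"
  shows "\<bar>(\<phi> q - \<phi> p) / (q - p) - \<phi>1 ((p + q) / 2)\<bar> \<le> K * H\<^sup>2"
proof -
  define t where "t = (q - p) / 2"
  define m where "m = (p + q) / 2"
  have t: "t > 0" "2 * t \<le> H" and q: "q = m + t" "p = m - t" using pq by (auto simp: t_def m_def field_simps)
  have K0: "K \<ge> 0" using bspec[OF K, of p] pq by force
  have 1: "\<bar>((\<phi> q - t\<^sup>2 / 2 * \<phi>2 q) - (\<phi> p - t\<^sup>2 / 2 * \<phi>2 p)) / (q - p) - \<phi>1 m\<bar> \<le> K * t\<^sup>2"
    using corrected_quotient[OF D K, of t t t m] t pq unfolding q by simp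
  have "\<bar>t\<^sup>2 / 2 * ((\<phi>2 q - \<phi>2 p) / (q - p))\<bar> \<le> t\<^sup>2 / 2 * K"
    unfolding abs_mult using Lipschitz_quotient[OF D(3) K pq(1-3)] by (intro mult_mono) auto
  moreover have "(\<phi> q - \<phi> p) / (q - p) - \<phi>1 m = ((\<phi> q - t\<^sup>2 / 2 * \<phi>2 q) - (\<phi> p - t\<^sup>2 / 2 * \<phi>2 p)) / (q - p) - \<phi>1 m
      + t\<^sup>2 / 2 * ((\<phi>2 q - \<phi>2 p) / (q - p))"
    by (simp add: diff_divide_distrib right_diff_distrib)
  moreover have "2 * (K * t\<^sup>2) \<le> K * H\<^sup>2"
  proof -
    have "(2 * t)\<^sup>2 \<le> H\<^sup>2" using t by (intro power_mono) auto
    then have "2 * t\<^sup>2 \<le> H\<^sup>2" by (simp add: power_mult_distrib) (use zero_le_power2[of t] in linarith)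
    then show ?thesis using mult_left_mono[OF _ K0] by fastforce
  qed
  moreover have "t\<^sup>2 / 2 * K = (K * t\<^sup>2) / 2" "0 \<le> K * t\<^sup>2" using K0 by simp_all
  ultimately show ?thesis using 1 unfolding m_def[symmetric] by linarith
qed

lemma deriv_bound_DERIV:
  assumes "deriv_bound a b K f"
  shows "\<And>y z. ((\<lambda>s. f s y) has_real_derivative pdx f z y) (at z)"
    "\<And>y z. ((\<lambda>s. pdx f s y) has_real_derivative pdx (pdx f) z y) (at z)"
    "\<And>y z. ((\<lambda>s. pdx (pdx f) s y) has_real_derivative pdx (pdx (pdx f)) z y) (at z)"
    "\<And>x z. ((\<lambda>t. f x t) has_real_derivative pdy f x z) (at z)"
    "\<And>x z. ((\<lambda>t. pdy f x t) has_real_derivative pdy (pdy f) x z) (at z)"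
    "\<And>x z. ((\<lambda>t. pdy (pdy f) x t) has_real_derivative pdy (pdy (pdy f)) x z) (at z)"
    "\<And>y z. ((\<lambda>s. pdy (pdy f) s y) has_real_derivative pdx (pdy (pdy f)) z y) (at z)"
proof -
  have 3: "Ck (Suc (Suc (Suc 0))) f" using assms by (simp add: deriv_bound_def eval_nat_numeral)
  note x = Ck_pdx[OF 3] Ck_pdx[OF Ck_pdx[OF 3]] Ck_pdy[OF 3] Ck_pdy[OF Ck_pdy[OF 3]]
  fix x y z
  show "((\<lambda>s. f s y) has_real_derivative pdx f z y) (at z)"
    "((\<lambda>s. pdx f s y) has_real_derivative pdx (pdx f) z y) (at z)"
    "((\<lambda>s. pdx (pdx f) s y) has_real_derivative pdx (pdx (pdx f)) z y) (at z)"
    "((\<lambda>t. f x t) has_real_derivative pdy f x z) (at z)"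
    "((\<lambda>t. pdy f x t) has_real_derivative pdy (pdy f) x z) (at z)"
    "((\<lambda>t. pdy (pdy f) x t) has_real_derivative pdy (pdy (pdy f)) x z) (at z)"
    "((\<lambda>s. pdy (pdy f) s y) has_real_derivative pdx (pdy (pdy f)) z y) (at z)"
    by (rule Ck_DERIV_x[OF 3] Ck_DERIV_x[OF x(1)] Ck_DERIV_x[OF x(2)] Ck_DERIV_y[OF 3]
        Ck_DERIV_y[OF x(3)] Ck_DERIV_y[OF x(4)] Ck_DERIV_x[OF x(4)])+
qed

lemma deriv_boundD:
  assumes "deriv_bound a b K f" "x \<in> {0..a}" "y \<in> {0..b}"
  shows "\<bar>pdx (pdx f) x y\<bar> \<le> K" "\<bar>pdy (pdy f) x y\<bar> \<le> K"
  using assms unfolding deriv_bound_def by blast+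

lemma deriv_bound_ball:
  assumes "deriv_bound a b K f"
  shows "y \<in> {0..b} \<Longrightarrow> \<forall>x\<in>{0..a}. \<bar>pdx (pdx (pdx f)) x y\<bar> \<le> K"
    "y \<in> {0..b} \<Longrightarrow> \<forall>x\<in>{0..a}. \<bar>pdx (pdy (pdy f)) x y\<bar> \<le> K"
    "x \<in> {0..a} \<Longrightarrow> \<forall>y\<in>{0..b}. \<bar>pdy (pdy (pdy f)) x y\<bar> \<le> K"
  using assms unfolding deriv_bound_def by blast+

lemma abs_diff_le_add:
  fixes K :: real
  assumes "\<bar>A - P\<bar> \<le> K * u" "\<bar>B\<bar> \<le> v * K"
  shows "\<bar>A - B - P\<bar> \<le> K * (u + v)"
  using assms unfolding distrib_left mult.commute[of v K] by linarith

section \<open>Geometry of the grid\<close>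

lemma coord_even [simp]: "coord xs (2 * i) = xs i"
  by (simp add: coord_def)

lemma coord_odd [simp]: "coord xs (Suc (2 * i)) = xs i + hh xs i / 2"
  by (simp add: coord_def hh_def field_simps)

lemma hh_le_hmax: "i < n \<Longrightarrow> hh xs i \<le> hmax xs n"
  by (simp add: hmax_def)

lemma grid_Suc: "xs (Suc i) = xs i + hh xs i"
  by (simp add: hh_def)

context
  fixes a n xs
  assumes grid: "is_grid a n xs"
begin

lemma hh_pos: "i < n \<Longrightarrow> hh xs i > 0"
  using grid by (simp add: is_grid_def hh_def)

lemma grid_less: "i < j \<Longrightarrow> j \<le> n \<Longrightarrow> xs i < xs j"
proof (induction j)
  case (Suc j)
  have "xs j < xs (Suc j)" using grid Suc.prems by (simp add: is_grid_def)
  with Suc show ?case by (cases "i = j") force+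
qed simp

lemma grid_range:
  assumes "i \<le> n"
  shows "0 \<le> xs i" "xs i \<le> a"
  using assms grid_less[of 0 i] grid_less[of i n] grid
  by (cases "i = 0"; cases "i = n"; force simp: is_grid_def)+

lemma grid_interior:
  assumes "0 < i" "i < n"
  shows "0 < xs i" "xs i < a"
  using assms grid_less[of 0 i] grid_less[of i n] grid by (auto simp: is_grid_def)

lemma centre_interior:
  assumes "i < n"
  shows "0 < xs i + hh xs i / 2" "xs i + hh xs i / 2 < a"
  using assms hh_pos[of i] grid_range[of i] grid_range[of "Suc i"] by (auto simp: grid_Suc)

lemma hn_pos: "n > 0 \<Longrightarrow> i \<le> n \<Longrightarrow> hn xs n i > 0"
  using hh_pos by (auto simp: hn_def intro!: add_pos_pos)

end

section \<open>Truncation errors of the interpolants\<close>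

context
  fixes a b nx ny xs ys
  assumes grids: "is_grid a nx xs" "is_grid b ny ys"
begin

text \<open>The quotient of exact values is centred. The y-correction has the same factor at both
  nodes, so only an x-quotient of the second y-derivative remains, and a mixed third derivative
  bounds it.\<close>

lemma dX_tux:
  assumes f: "deriv_bound a b K u" and ij: "i < nx" "j < ny"
  shows "\<bar>dX xs (tux xs ys u) i (2 * j + 1) - pdx u (coord xs (2 * i + 1)) (coord ys (2 * j + 1))\<bar>
    \<le> K * ((hmax xs nx)\<^sup>2 + (hmax ys ny)\<^sup>2)"
proof -
  define Y where "Y = ys j + hh ys j / 2"
  have Y: "Y \<in> {0..b}" using centre_interior[OF grids(2) ij(2)] by (simp add: Y_def)
  have p: "0 \<le> xs i" "xs i < xs (Suc i)" "xs (Suc i) \<le> a" "xs (Suc i) - xs i \<le> hmax xs nx"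
    using ij grid_range[OF grids(1)] grid_less[OF grids(1), of i "Suc i"] hh_le_hmax[of i nx xs]
    by (auto simp: hh_def)
  have m: "(xs i + xs (Suc i)) / 2 = xs i + hh xs i / 2" by (simp add: hh_def field_simps)
  let ?c = "(u (xs (Suc i)) Y - u (xs i) Y) / (xs (Suc i) - xs i)"
  let ?d = "(pdy (pdy u) (xs (Suc i)) Y - pdy (pdy u) (xs i) Y) / (xs (Suc i) - xs i)"
  have 1: "\<bar>?c - pdx u (xs i + hh xs i / 2) Y\<bar> \<le> K * (hmax xs nx)\<^sup>2"
    using central_quotient[OF deriv_bound_DERIV(1-3)[OF f] deriv_bound_ball(1)[OF f Y] p] by (simp add: m)
  have "\<bar>(hh ys j)\<^sup>2 / 8 * ?d\<bar> \<le> (hmax ys ny)\<^sup>2 * K"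
    unfolding abs_mult
  proof (rule mult_mono)
    show "\<bar>?d\<bar> \<le> K"
      by (rule Lipschitz_quotient[OF deriv_bound_DERIV(7)[OF f] deriv_bound_ball(2)[OF f Y] p(1-3)])
    have "(hh ys j)\<^sup>2 \<le> (hmax ys ny)\<^sup>2"
      using hh_pos[OF grids(2) ij(2)] hh_le_hmax[OF ij(2), of ys] by (intro power_mono) auto
    then show "\<bar>(hh ys j)\<^sup>2 / 8\<bar> \<le> (hmax ys ny)\<^sup>2" using zero_le_power2[of "hh ys j"] by linarith
  qed auto
  moreover have "dX xs (tux xs ys u) i (2 * j + 1) = ?c - (hh ys j)\<^sup>2 / 8 * ?d"
    using coord_even[of xs "Suc i"]
    by (simp add: dX_def tux_def Let_def Y_def[symmetric] hh_def[of xs] diff_divide_distrib right_diff_distrib)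
  ultimately show ?thesis using abs_diff_le_add[OF 1] by (simp add: Y_def[symmetric])
qed

text \<open>The two cell centres lie at distances \<open>r\<close> and \<open>s'\<close> from the
  node, with sum \<open>hn xs nx i\<close>. In these half lengths the factor
  \<open>(hh xs i)\<^sup>2 / 8\<close> becomes \<open>r\<^sup>2 / 2\<close>, the factor that
  \<open>corrected_quotient\<close> requires.\<close>

lemma DX_tsig_diag:
  assumes f: "deriv_bound a b K s" and ij: "1 \<le> i" "i < nx" "j < ny"
  shows "\<bar>DX xs nx (tsig_diag xs ys s) i (2 * j + 1) - pdx s (xs i) (coord ys (2 * j + 1))\<bar>
    \<le> K * ((hmax xs nx)\<^sup>2 + (hmax ys ny)\<^sup>2)"
proof -
  obtain i' where i': "i = Suc i'" using ij by (cases i) auto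
  define Y where "Y = ys j + hh ys j / 2"
  define p where "p = xs i"
  define r s' where "r = hh xs i / 2" and "s' = hh xs i' / 2"
  have Y: "Y \<in> {0..b}" using centre_interior[OF grids(2) ij(3)] by (simp add: Y_def)
  have rs: "0 < r" "0 < s'" "r \<le> hmax xs nx" "s' \<le> hmax xs nx"
    using ij i' hh_le_hmax[of i nx xs] hh_le_hmax[of i' nx xs]
      hh_pos[OF grids(1), of i] hh_pos[OF grids(1), of i']
    by (auto simp: r_def s'_def)
  have L: "0 \<le> p - s'" "p + r \<le> a"
    using centre_interior[OF grids(1), of i] centre_interior[OF grids(1), of i'] ij i'
    by (auto simp: p_def r_def s'_def grid_Suc)
  have hn: "hn xs nx i = r + s'" using ij i' by (simp add: hn_def r_def s'_def field_simps)
  let ?c = "((s (p + r) Y - r\<^sup>2 / 2 * pdx (pdx s) (p + r) Y)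
    - (s (p - s') Y - s'\<^sup>2 / 2 * pdx (pdx s) (p - s') Y)) / (r + s')"
  let ?d = "(pdy (pdy s) (p + r) Y - pdy (pdy s) (p - s') Y) / (p + r - (p - s'))"
  have 1: "\<bar>?c - pdx s p Y\<bar> \<le> K * (hmax xs nx)\<^sup>2"
    using corrected_quotient[OF deriv_bound_DERIV(1-3)[OF f] deriv_bound_ball(1)[OF f Y] _ _ _ rs(3,4) L] rs
    by simp
  have "\<bar>(hh ys j)\<^sup>2 / 8 * ?d\<bar> \<le> (hmax ys ny)\<^sup>2 * K"
    unfolding abs_mult
  proof (rule mult_mono)
    show "\<bar>?d\<bar> \<le> K"
      by (rule Lipschitz_quotient[OF deriv_bound_DERIV(7)[OF f] deriv_bound_ball(2)[OF f Y] L(1) _ L(2)])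
        (use rs in auto)
    have "(hh ys j)\<^sup>2 \<le> (hmax ys ny)\<^sup>2"
      using hh_pos[OF grids(2) ij(3)] hh_le_hmax[OF ij(3), of ys] by (intro power_mono) auto
    then show "\<bar>(hh ys j)\<^sup>2 / 8\<bar> \<le> (hmax ys ny)\<^sup>2" using zero_le_power2[of "hh ys j"] by linarith
  qed auto
  moreover have "DX xs nx (tsig_diag xs ys s) i (2 * j + 1) = ?c - (hh ys j)\<^sup>2 / 8 * ?d"
  proof -
    have "xs i' + hh xs i' / 2 = p - s'" by (simp add: p_def s'_def i' grid_Suc)
    moreover have "xs i + hh xs i / 2 = p + r" by (simp add: p_def r_def)
    moreover have "(hh xs i)\<^sup>2 / 8 = r\<^sup>2 / 2" "(hh xs i')\<^sup>2 / 8 = s'\<^sup>2 / 2"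
      by (simp_all add: r_def s'_def power2_eq_square)
    moreover have "2 * i - 1 = Suc (2 * i')" by (simp add: i')
    ultimately have "DX xs nx (tsig_diag xs ys s) i (2 * j + 1) =
       ((s (p + r) Y - r\<^sup>2 / 2 * pdx (pdx s) (p + r) Y - (hh ys j)\<^sup>2 / 8 * pdy (pdy s) (p + r) Y) -
       (s (p - s') Y - s'\<^sup>2 / 2 * pdx (pdx s) (p - s') Y - (hh ys j)\<^sup>2 / 8 * pdy (pdy s) (p - s') Y)) / (r + s')"
      using ij by (simp add: DX_def tsig_diag_def Let_def Y_def[symmetric] hn)
    also have "\<dots> = ?c - (hh ys j)\<^sup>2 / 8 * ?d"
      by (simp add: diff_divide_distrib right_diff_distrib)
    finally show ?thesis .
  qed
  ultimately show ?thesis using abs_diff_le_add[OF 1] by (simp add: Y_def[symmetric] p_def[symmetric])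
qed

lemma dY_tsig_off:
  assumes f: "deriv_bound a b K s" and ij: "i \<le> nx" "j < ny"
  shows "\<bar>dY ys (tsig_off xs ys s) (2 * i) j - pdy s (xs i) (coord ys (2 * j + 1))\<bar>
    \<le> K * ((hmax xs nx)\<^sup>2 + (hmax ys ny)\<^sup>2)"
proof -
  have X: "xs i \<in> {0..a}" using grid_range[OF grids(1) ij(1)] by simp
  have p: "0 \<le> ys j" "ys j < ys (Suc j)" "ys (Suc j) \<le> b" "ys (Suc j) - ys j \<le> hmax ys ny"
    using ij grid_range[OF grids(2)] grid_less[OF grids(2), of j "Suc j"] hh_le_hmax[of j ny ys]
    by (auto simp: hh_def)
  have K0: "K \<ge> 0" using deriv_boundD(1)[OF f X, of 0] p by force
  have m: "(ys j + ys (Suc j)) / 2 = ys j + hh ys j / 2" by (simp add: hh_def field_simps)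
  have "\<bar>(s (xs i) (ys (Suc j)) - s (xs i) (ys j)) / hh ys j - pdy s (xs i) (ys j + hh ys j / 2)\<bar>
      \<le> K * (hmax ys ny)\<^sup>2"
    using central_quotient[OF deriv_bound_DERIV(4-6)[OF f] deriv_bound_ball(3)[OF f X] p] by (simp add: m hh_def)
  also have "\<dots> \<le> K * ((hmax xs nx)\<^sup>2 + (hmax ys ny)\<^sup>2)" using K0 by (intro mult_left_mono) auto
  finally show ?thesis using coord_even[of ys "Suc j"] by (simp add: dY_def tsig_off_def)
qed

text \<open>The constitutive law uses stress values and not their differences, so there the
  correction itself is the consistency error.\<close>

lemma tsig_diag_error:
  assumes f: "deriv_bound a b K s" and ij: "i < nx" "j < ny"
  shows "\<bar>tsig_diag xs ys s (2 * i + 1) (2 * j + 1) - s (coord xs (2 * i + 1)) (coord ys (2 * j + 1))\<bar>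
    \<le> K * ((hmax xs nx)\<^sup>2 + (hmax ys ny)\<^sup>2)"
proof -
  define X Y where "X = xs i + hh xs i / 2" and "Y = ys j + hh ys j / 2"
  have XY: "X \<in> {0..a}" "Y \<in> {0..b}"
    using centre_interior[OF grids(1) ij(1)] centre_interior[OF grids(2) ij(2)] by (auto simp: X_def Y_def)
  have "(hh xs i)\<^sup>2 \<le> (hmax xs nx)\<^sup>2" "(hh ys j)\<^sup>2 \<le> (hmax ys ny)\<^sup>2"
    using hh_pos[OF grids(1) ij(1)] hh_le_hmax[OF ij(1), of xs] hh_pos[OF grids(2) ij(2)] hh_le_hmax[OF ij(2), of ys]
    by (auto intro: power_mono)
  then have le: "\<bar>(hh xs i)\<^sup>2 / 8\<bar> \<le> (hmax xs nx)\<^sup>2" "\<bar>(hh ys j)\<^sup>2 / 8\<bar> \<le> (hmax ys ny)\<^sup>2"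
    using zero_le_power2[of "hh xs i"] zero_le_power2[of "hh ys j"] by linarith+
  have "\<bar>(hh xs i)\<^sup>2 / 8 * pdx (pdx s) X Y\<bar> \<le> (hmax xs nx)\<^sup>2 * K"
    unfolding abs_mult using le deriv_boundD(1)[OF f XY] by (intro mult_mono) auto
  moreover have "\<bar>(hh ys j)\<^sup>2 / 8 * pdy (pdy s) X Y\<bar> \<le> (hmax ys ny)\<^sup>2 * K"
    unfolding abs_mult using le deriv_boundD(2)[OF f XY] by (intro mult_mono) auto
  moreover have "tsig_diag xs ys s (2 * i + 1) (2 * j + 1) - s X Y
      = - ((hh xs i)\<^sup>2 / 8 * pdx (pdx s) X Y) - (hh ys j)\<^sup>2 / 8 * pdy (pdy s) X Y"
    by (simp add: tsig_diag_def Let_def X_def Y_def)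
  ultimately have "\<bar>tsig_diag xs ys s (2 * i + 1) (2 * j + 1) - s X Y\<bar>
      \<le> K * ((hmax xs nx)\<^sup>2 + (hmax ys ny)\<^sup>2)"
    unfolding distrib_left mult.commute[of K] by linarith
  then show ?thesis by (simp add: X_def Y_def)
qed

lemma DY_tux:
  assumes f: "deriv_bound a b K u" and ij: "i \<le> nx" "j \<le> ny" and ny: "ny > 0"
    and bdry: "u (xs i) 0 = 0" "u (xs i) b = 0"
  shows "\<bar>DY ys ny (\<lambda>k m. if m = 0 \<or> m = 2 * ny then 0 else tux xs ys u k m) (2 * i) j - pdy u (xs i) (ys j)\<bar>
    \<le> K * ((hmax xs nx)\<^sup>2 + (hmax ys ny)\<^sup>2)"
proof -
  define X where "X = xs i"
  let ?T = "\<lambda>k m. if m = 0 \<or> m = 2 * ny then 0 else tux xs ys u k m"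
  define v where "v = (\<lambda>j. u X (ys j + hh ys j / 2) - (hh ys j / 2)\<^sup>2 / 2 * pdy (pdy u) X (ys j + hh ys j / 2))"
  have X: "X \<in> {0..a}" using grid_range[OF grids(1) ij(1)] by (simp add: X_def)
  note cq = corrected_quotient[OF deriv_bound_DERIV(4-6)[OF f] deriv_bound_ball(3)[OF f X], where H = "hmax ys ny"]
  have T: "?T (2 * i) (Suc (2 * j)) = v j" if "j < ny" for j
    using that by (auto simp: v_def tux_def X_def Let_def power2_eq_square)
  have odd: "Suc (2 * j) \<noteq> 2 * k" for j k :: nat by presburger
  have half: "0 \<le> hh ys j / 2 \<and> 0 < hh ys j / 2 \<and> hh ys j / 2 \<le> hmax ys ny
      \<and> ys j + hh ys j / 2 \<le> b \<and> 0 \<le> ys j + hh ys j / 2" if "j < ny" for j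
    using hh_pos[OF grids(2) that] hh_le_hmax[OF that, of ys] centre_interior[OF grids(2) that] by auto
  have ends: "ys 0 = 0" "ys ny = b" using grids(2) by (auto simp: is_grid_def)
  have "\<bar>DY ys ny ?T (2 * i) j - pdy u X (ys j)\<bar> \<le> K * (hmax ys ny)\<^sup>2"
  proof -
    \<comment> \<open>The three cases differ only in the lengths given to
      \<open>corrected_quotient\<close>: the lower length is zero at the bottom side, the upper one
      at the top side, and both are half cells at an interior node.\<close>
    consider "j = 0" | "j = ny" | j' where "j = Suc j'" "j < ny" using ij by (cases j) force+
    then show ?thesis
    proof cases
      case 1
      have "\<bar>(v 0 - 0) / (hh ys 0 / 2) - pdy u X (ys 0)\<bar> \<le> K * (hmax ys ny)\<^sup>2"
        using cq[of "hh ys 0 / 2" 0 "ys 0"] half[OF ny] bdry by (simp add: ends v_def X_def)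
      then show ?thesis using 1 T[OF ny] by (simp add: DY_def hn_def)
    next
      case 2
      define k where "k = ny - 1"
      have k: "ny = Suc k" "k < ny" using ny by (auto simp: k_def)
      have e: "ys ny - hh ys k / 2 = ys k + hh ys k / 2" using k by (simp add: grid_Suc)
      have le: "\<bar>(0 - v k) / (hh ys k / 2) - pdy u X (ys ny)\<bar> \<le> K * (hmax ys ny)\<^sup>2"
        using cq[of 0 "hh ys k / 2" "ys ny"] half[OF k(2)] bdry ends e by (simp add: v_def X_def add.commute)
      have "2 * ny - 1 = Suc (2 * k)" using k by simp
      moreover have hn: "hn ys ny ny = hh ys k / 2" using k by (simp add: hn_def)
      ultimately have "DY ys ny ?T (2 * i) j = (0 - v k) / (hh ys k / 2)"
        unfolding hn[symmetric] using 2 T[OF k(2)] ny odd[of k ny] by (auto simp: DY_def)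
      with le 2 show ?thesis by simp
    next
      case 3
      have j': "j' < ny" using 3 by simp
      have e: "ys j - hh ys j' / 2 = ys j' + hh ys j' / 2" using 3 by (simp add: grid_Suc)
      have "\<bar>(v j - v j') / (hh ys j / 2 + hh ys j' / 2) - pdy u X (ys j)\<bar> \<le> K * (hmax ys ny)\<^sup>2"
        using cq[of "hh ys j / 2" "hh ys j' / 2" "ys j"] half[OF 3(2)] half[OF j'] e by (simp add: v_def)
      moreover have "2 * j - 1 = Suc (2 * j')" using 3 by simp
      moreover have "hn ys ny j = hh ys j / 2 + hh ys j' / 2" using 3 by (simp add: hn_def add_divide_distrib)
      ultimately show ?thesis using 3 T[OF 3(2)] T[OF j'] by (simp add: DY_def)
    qed
  qed
  moreover have "K * (hmax ys ny)\<^sup>2 \<le> K * ((hmax xs nx)\<^sup>2 + (hmax ys ny)\<^sup>2)"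
    using deriv_boundD(1)[OF f X, of "ys j"] grid_range[OF grids(2) ij(2)] by (intro mult_left_mono) force+
  ultimately show ?thesis unfolding X_def by linarith
qed

end

section \<open>Discrete summation by parts and Poincare inequality\<close>

text \<open>The four discrete inner products differ only in index ranges and weights; one weighted
  double sum lets linearity, monotonicity and exchange of directions be proved once.\<close>

definition wsum :: "nat set \<Rightarrow> nat set \<Rightarrow> (nat \<Rightarrow> real) \<Rightarrow> (nat \<Rightarrow> real) \<Rightarrow> (nat \<Rightarrow> nat \<Rightarrow> real) \<Rightarrow> real" where
  "wsum I J v w f = (\<Sum>i\<in>I. \<Sum>j\<in>J. v i * w j * f i j)"

lemma wsum_add: "wsum I J v w (\<lambda>i j. f i j + g i j) = wsum I J v w f + wsum I J v w g"
  by (simp add: wsum_def distrib_left sum.distrib)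

lemma wsum_cmult: "wsum I J v w (\<lambda>i j. c * f i j) = c * wsum I J v w f"
  by (simp add: wsum_def sum_distrib_left mult_ac)

lemma wsum_const: "wsum I J v w (\<lambda>i j. c) = c * (sum v I * sum w J)"
  unfolding wsum_def sum_product by (simp add: sum_distrib_left mult_ac)

lemma wsum_mono:
  assumes "\<And>i. i \<in> I \<Longrightarrow> v i \<ge> 0" "\<And>j. j \<in> J \<Longrightarrow> w j \<ge> 0"
    and "\<And>i j. i \<in> I \<Longrightarrow> j \<in> J \<Longrightarrow> f i j \<le> g i j"
  shows "wsum I J v w f \<le> wsum I J v w g"
  unfolding wsum_def using assms by (intro sum_mono mult_left_mono) auto

lemma wsum_swap: "wsum J I w v (\<lambda>j i. f i j) = wsum I J v w f"
  unfolding wsum_def by (subst sum.swap) (simp add: mult_ac)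

lemma wsum_left: "wsum I J v w f = (\<Sum>j\<in>J. w j * (\<Sum>i\<in>I. v i * f i j))"
  unfolding wsum_def by (subst sum.swap) (simp add: sum_distrib_left mult_ac)

lemma wsum_right: "wsum I J v w f = (\<Sum>i\<in>I. v i * (\<Sum>j\<in>J. w j * f i j))"
  unfolding wsum_def by (simp add: sum_distrib_left mult_ac)

section \<open>One-dimensional summation by parts and Poincare inequality\<close>

lemma summation_by_parts_nodes:
  fixes P e :: "nat \<Rightarrow> real"
  assumes "n > 0"
  shows "(\<Sum>i\<in>{1..<n}. (P i - P (i - 1)) * e i) + (\<Sum>i<n. P i * (e (Suc i) - e i))
    = P (n - 1) * e n - P 0 * e 0"
proof -
  have "(\<Sum>i\<in>{1..<Suc n}. (P i - P (i - 1)) * e i) + (\<Sum>i<Suc n. P i * (e (Suc i) - e i))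
      = P n * e (Suc n) - P 0 * e 0" for n
    by (induction n) (simp_all add: algebra_simps)
  from this[of "n - 1"] show ?thesis using assms by simp
qed

text \<open>The 0 in place of a value before the first centre stands for the vanishing boundary
  displacement, so the difference at \<open>j = 0\<close> is the numerator of the half-cell
  quotient. The right-hand side plays the same part at the far end.\<close>

lemma summation_by_parts_centres:
  fixes Q e :: "nat \<Rightarrow> real"
  assumes "n > 0"
  shows "(\<Sum>j<n. (Q (Suc j) - Q j) * e j) + (\<Sum>j<n. Q j * (e j - (if j = 0 then 0 else e (j - 1))))
    = Q n * e (n - 1)"
proof -
  have "(\<Sum>j<Suc n. (Q (Suc j) - Q j) * e j) + (\<Sum>j<Suc n. Q j * (e j - (if j = 0 then 0 else e (j - 1))))
      = Q (Suc n) * e n" for n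
    by (induction n) (simp_all add: algebra_simps)
  from this[of "n - 1"] show ?thesis using assms by simp
qed

lemma dY_transpose: "dY ys \<phi> k j = dX ys (\<lambda>m k. \<phi> k m) j k"
  by (simp add: dX_def dY_def)

lemma DY_transpose: "DY ys n \<phi> k j = DX ys n (\<lambda>m k. \<phi> k m) j k"
  by (simp add: DX_def DY_def)

context
  fixes a n xs
  assumes a: "a > 0" and grid: "is_grid a n xs"
begin

lemma grid_card_pos: "n > 0"
  using a grid by (cases n) (auto simp: is_grid_def)

lemma sum_hh: "(\<Sum>i<n. hh xs i) = a"
  using grid by (simp add: hh_def sum_lessThan_telescope is_grid_def)

lemma sum_hn: "(\<Sum>i\<le>n. hn xs n i) = a"
proof -
  have "(\<Sum>i\<le>k. hn xs n i) = xs k - xs 0 + hh xs k / 2" if "k < n" for k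
    using that by (induction k) (auto simp: hn_def grid_Suc field_simps)
  from this[of "n - 1"] have "(\<Sum>i\<le>n - 1. hn xs n i) = xs (n - 1) - xs 0 + hh xs (n - 1) / 2"
    using grid_card_pos by simp
  moreover have "(\<Sum>i\<le>n. hn xs n i) = (\<Sum>i\<le>n - 1. hn xs n i) + hn xs n n"
    using grid_card_pos by (cases n) auto
  moreover have "xs n = xs (n - 1) + hh xs (n - 1)" using grid_Suc[of xs "n - 1"] grid_card_pos by simp
  ultimately show ?thesis using grid grid_card_pos by (simp add: hn_def is_grid_def)
qed

lemma sum_hn_interior: "(\<Sum>i\<in>{1..<n}. hn xs n i) \<le> a"
proof -
  have "(\<Sum>i\<in>{1..<n}. hn xs n i) \<le> (\<Sum>i\<le>n. hn xs n i)"
    using hn_pos[OF grid grid_card_pos] by (intro sum_mono2) (auto intro: less_imp_le)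
  then show ?thesis using sum_hn by simp
qed

lemma sbp_DX:
  assumes "E 0 m = 0" "E (2 * n) m = 0"
  shows "(\<Sum>i\<in>{1..<n}. hn xs n i * (DX xs n S i m * E (2 * i) m))
    = - (\<Sum>i<n. hh xs i * (S (2 * i + 1) m * dX xs E i m))"
proof -
  have "(\<Sum>i\<in>{1..<n}. hn xs n i * (DX xs n S i m * E (2 * i) m))
      = (\<Sum>i\<in>{1..<n}. (S (2 * i + 1) m - S (2 * (i - 1) + 1) m) * E (2 * i) m)"
  proof (rule sum.cong)
    fix i assume i: "i \<in> {1..<n}"
    have "2 * i - 1 = 2 * (i - 1) + 1" using i by auto
    then show "hn xs n i * (DX xs n S i m * E (2 * i) m) = (S (2 * i + 1) m - S (2 * (i - 1) + 1) m) * E (2 * i) m"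
      using hn_pos[OF grid grid_card_pos, of i] i by (simp add: DX_def)
  qed simp
  moreover have "(\<Sum>i<n. hh xs i * (S (2 * i + 1) m * dX xs E i m))
      = (\<Sum>i<n. S (2 * i + 1) m * (E (2 * Suc i) m - E (2 * i) m))"
  proof (rule sum.cong)
    fix i assume "i \<in> {..<n}"
    then show "hh xs i * (S (2 * i + 1) m * dX xs E i m) = S (2 * i + 1) m * (E (2 * Suc i) m - E (2 * i) m)"
      using hh_pos[OF grid, of i] by (simp add: dX_def)
  qed simp
  ultimately show ?thesis
    using summation_by_parts_nodes[OF grid_card_pos, of "\<lambda>i. S (2 * i + 1) m" "\<lambda>i. E (2 * i) m"] assms
    by simp
qed

text \<open>At every node, including the ends where it is half a cell, the weight \<open>hn\<close>
  is the denominator of \<open>DY\<close> and cancels it, so the identity is exact on a non-uniform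
  grid. The one-sided quotient at node \<open>n\<close> supplies the term left over by
  \<open>summation_by_parts_centres\<close>.\<close>

lemma sbp_DY:
  assumes "E k 0 = 0" "E k (2 * n) = 0"
  shows "(\<Sum>j<n. hh xs j * (dY xs T k j * E k (2 * j + 1)))
    = - (\<Sum>j\<le>n. hn xs n j * (T k (2 * j) * DY xs n E k j))"
proof -
  let ?e = "\<lambda>j. E k (2 * j + 1)" and ?Q = "\<lambda>j. T k (2 * j)"
  have hn0: "hn xs n j \<noteq> 0" if "j \<le> n" for j using hn_pos[OF grid grid_card_pos that] by simp
  have "(\<Sum>j<n. hh xs j * (dY xs T k j * ?e j)) = (\<Sum>j<n. (?Q (Suc j) - ?Q j) * ?e j)"
  proof (rule sum.cong)
    fix j assume "j \<in> {..<n}"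
    then show "hh xs j * (dY xs T k j * ?e j) = (?Q (Suc j) - ?Q j) * ?e j"
      using hh_pos[OF grid, of j] by (simp add: dY_def)
  qed simp
  moreover have "(\<Sum>j<n. hn xs n j * (?Q j * DY xs n E k j))
      = (\<Sum>j<n. ?Q j * (?e j - (if j = 0 then 0 else ?e (j - 1))))"
  proof (rule sum.cong)
    fix j assume j: "j \<in> {..<n}"
    have "j \<noteq> 0 \<Longrightarrow> 2 * j - 1 = 2 * (j - 1) + 1" by auto
    then show "hn xs n j * (?Q j * DY xs n E k j) = ?Q j * (?e j - (if j = 0 then 0 else ?e (j - 1)))"
      using hn0[of j] hn0[of 0] j assms by (simp add: DY_def)
  qed simp
  moreover have "hn xs n n * (?Q n * DY xs n E k n) = - (?Q n * ?e (n - 1))"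
  proof -
    have "2 * n - 1 = 2 * (n - 1) + 1" using grid_card_pos by auto
    then show ?thesis using hn0[of n] grid_card_pos assms by (simp add: DY_def)
  qed
  moreover have "(\<Sum>j\<le>n. hn xs n j * (?Q j * DY xs n E k j))
      = (\<Sum>j<n. hn xs n j * (?Q j * DY xs n E k j)) + hn xs n n * (?Q n * DY xs n E k n)"
    by (simp add: lessThan_Suc_atMost[symmetric])
  ultimately show ?thesis
    using summation_by_parts_centres[OF grid_card_pos, of ?Q ?e] by simp
qed

lemma discrete_Poincare:
  fixes e :: "nat \<Rightarrow> real"
  assumes e0: "e 0 = 0"
  shows "(\<Sum>i\<in>{1..<n}. hn xs n i * (e i)\<^sup>2) \<le> a\<^sup>2 * (\<Sum>i<n. hh xs i * ((e (Suc i) - e i) / hh xs i)\<^sup>2)"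
proof -
  let ?d = "\<lambda>i. (e (Suc i) - e i) / hh xs i"
  let ?D = "\<Sum>i<n. hh xs i * (?d i)\<^sup>2"
  have nn: "0 \<le> hh xs i * (?d i)\<^sup>2" if "i < n" for i
    using hh_pos[OF grid that] by simp
  then have D: "0 \<le> ?D" by (intro sum_nonneg) auto
  have pt: "(e i)\<^sup>2 \<le> a * ?D" if i: "i \<in> {1..<n}" for i
  proof -
    have "e i = (\<Sum>k<i. e (Suc k) - e k)" using e0 by (simp add: sum_lessThan_telescope)
    \<comment> \<open>Each length is split into two square roots, so that Cauchy-Schwarz puts the
      plain lengths into one factor, of total at most \<open>a\<close>, and the weighted squared
      slopes into the other.\<close>
    also have "\<dots> = (\<Sum>k<i. sqrt (hh xs k) * (sqrt (hh xs k) * ?d k))"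
    proof (rule sum.cong)
      fix k assume "k \<in> {..<i}"
      then have "hh xs k > 0" using hh_pos[OF grid, of k] i by auto
      then show "e (Suc k) - e k = sqrt (hh xs k) * (sqrt (hh xs k) * ?d k)"
        by (simp flip: mult.assoc)
    qed simp
    finally have "(e i)\<^sup>2 \<le> (\<Sum>k<i. (sqrt (hh xs k))\<^sup>2) * (\<Sum>k<i. (sqrt (hh xs k) * ?d k)\<^sup>2)"
      by (simp only: Cauchy_Schwarz_ineq_sum)
    also have "\<dots> = (\<Sum>k<i. hh xs k) * (\<Sum>k<i. hh xs k * (?d k)\<^sup>2)"
    proof -
      have "(sqrt (hh xs k))\<^sup>2 = hh xs k" if "k < i" for k
        using hh_pos[OF grid, of k] i that by simp
      then show ?thesis
        unfolding power_mult_distrib by (intro arg_cong2[where f = "(*)"] sum.cong) simp_all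
    qed
    also have "\<dots> \<le> (\<Sum>k<n. hh xs k) * ?D"
      using i nn hh_pos[OF grid] by (intro mult_mono sum_mono2 sum_nonneg) (auto intro: less_imp_le)
    finally show ?thesis unfolding sum_hh .
  qed
  have "(\<Sum>i\<in>{1..<n}. hn xs n i * (e i)\<^sup>2) \<le> (\<Sum>i\<in>{1..<n}. hn xs n i * (a * ?D))"
    using hn_pos[OF grid grid_card_pos] pt by (intro sum_mono mult_left_mono) (auto intro: less_imp_le)
  also have "\<dots> = (\<Sum>i\<in>{1..<n}. hn xs n i) * (a * ?D)" by (simp add: sum_distrib_right)
  also have "\<dots> \<le> a * (a * ?D)" using sum_hn_interior D a by (intro mult_right_mono) auto
  finally show ?thesis by (simp add: power2_eq_square mult.assoc)
qed

end

section \<open>Testing the momentum equations; Poincare inequality on the rectangle\<close>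

context
  fixes a b nx ny xs ys
  assumes ab: "a > 0" "b > 0" and grids: "is_grid a nx xs" "is_grid b ny ys"
begin

lemma weak_momentum:
  assumes E: "\<And>j. j < ny \<Longrightarrow> E 0 (2 * j + 1) = 0" "\<And>j. j < ny \<Longrightarrow> E (2 * nx) (2 * j + 1) = 0"
    "\<And>i. i \<le> nx \<Longrightarrow> E (2 * i) 0 = 0" "\<And>i. i \<le> nx \<Longrightarrow> E (2 * i) (2 * ny) = 0"
  shows "wsum {1..<nx} {..<ny} (hn xs nx) (hh ys)
      (\<lambda>i j. (DX xs nx S i (2 * j + 1) + dY ys T (2 * i) j) * E (2 * i) (2 * j + 1))
    = - wsum {..<nx} {..<ny} (hh xs) (hh ys) (\<lambda>i j. S (2 * i + 1) (2 * j + 1) * dX xs E i (2 * j + 1))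
      - wsum {..nx} {..ny} (hn xs nx) (hn ys ny) (\<lambda>i j. T (2 * i) (2 * j) * DY ys ny E (2 * i) j)"
proof -
  have nx: "nx > 0" and ny: "ny > 0"
    using grid_card_pos[OF ab(1) grids(1)] grid_card_pos[OF ab(2) grids(2)] .
  have 1: "wsum {1..<nx} {..<ny} (hn xs nx) (hh ys) (\<lambda>i j. DX xs nx S i (2 * j + 1) * E (2 * i) (2 * j + 1))
    = - wsum {..<nx} {..<ny} (hh xs) (hh ys) (\<lambda>i j. S (2 * i + 1) (2 * j + 1) * dX xs E i (2 * j + 1))"
    unfolding wsum_left using sbp_DX[OF ab(1) grids(1), of E _ S] E(1,2) by (simp add: sum_negf)
  have 2: "wsum {1..<nx} {..<ny} (hn xs nx) (hh ys) (\<lambda>i j. dY ys T (2 * i) j * E (2 * i) (2 * j + 1))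
    = - wsum {1..<nx} {..ny} (hn xs nx) (hn ys ny) (\<lambda>i j. T (2 * i) (2 * j) * DY ys ny E (2 * i) j)"
    unfolding wsum_right using sbp_DY[OF ab(2) grids(2), of E "2 * _" T] E(3,4) by (simp add: sum_negf)
  \<comment> \<open>The momentum equation is tested only at interior \<open>i\<close>, but the shear
    inner product also contains the nodes on the two vertical sides. The test function vanishes
    along these sides, hence so do its tangential quotients, and the sum may be extended to all
    nodes.\<close>
  have 3: "DY ys ny E (2 * i) j = 0" if "i = 0 \<or> i = nx" "j \<le> ny" for i j
  proof -
    have z: "E (2 * i) 0 = 0" "E (2 * i) (2 * ny) = 0" using E(3,4) that nx by auto
    have odd: "E (2 * i) (2 * j + 1) = 0" if "j < ny" for j using E(1,2) that \<open>i = 0 \<or> i = nx\<close> by auto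
    have "2 * j - 1 = 2 * (j - 1) + 1" if "j \<noteq> 0" using that by auto
    then show ?thesis using z odd[of j] odd[of "j - 1"] odd[of 0] ny \<open>j \<le> ny\<close>
      by (auto simp: DY_def)
  qed
  have "wsum {..nx} {..ny} (hn xs nx) (hn ys ny) (\<lambda>i j. T (2 * i) (2 * j) * DY ys ny E (2 * i) j)
      = wsum {1..<nx} {..ny} (hn xs nx) (hn ys ny) (\<lambda>i j. T (2 * i) (2 * j) * DY ys ny E (2 * i) j)"
    unfolding wsum_right
  proof (rule sum.mono_neutral_right)
    show "\<forall>i\<in>{..nx} - {1..<nx}. hn xs nx i * (\<Sum>j\<in>{..ny}. hn ys ny j * (T (2 * i) (2 * j) * DY ys ny E (2 * i) j)) = 0"
    proof
      fix i assume "i \<in> {..nx} - {1..<nx}"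
      then have "i = 0 \<or> i = nx" by auto
      then show "hn xs nx i * (\<Sum>j\<in>{..ny}. hn ys ny j * (T (2 * i) (2 * j) * DY ys ny E (2 * i) j)) = 0"
        using 3 by simp
    qed
  qed auto
  then show ?thesis unfolding distrib_right wsum_add 1 2 by simp
qed

lemma wsum_Poincare:
  assumes E: "\<And>j. j < ny \<Longrightarrow> E 0 (2 * j + 1) = 0"
  shows "wsum {1..<nx} {..<ny} (hn xs nx) (hh ys) (\<lambda>i j. (E (2 * i) (2 * j + 1))\<^sup>2)
    \<le> a\<^sup>2 * wsum {..<nx} {..<ny} (hh xs) (hh ys) (\<lambda>i j. (dX xs E i (2 * j + 1))\<^sup>2)"
proof -
  have "hh ys j * (\<Sum>i\<in>{1..<nx}. hn xs nx i * (E (2 * i) (2 * j + 1))\<^sup>2)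
      \<le> hh ys j * (a\<^sup>2 * (\<Sum>i<nx. hh xs i * (dX xs E i (2 * j + 1))\<^sup>2))" if "j < ny" for j
    using discrete_Poincare[OF ab(1) grids(1), of "\<lambda>i. E (2 * i) (2 * j + 1)"] E[OF that] hh_pos[OF grids(2) that]
    by (intro mult_left_mono) (simp_all add: dX_def)
  then have "(\<Sum>j<ny. hh ys j * (\<Sum>i\<in>{1..<nx}. hn xs nx i * (E (2 * i) (2 * j + 1))\<^sup>2))
      \<le> (\<Sum>j<ny. a\<^sup>2 * (hh ys j * (\<Sum>i<nx. hh xs i * (dX xs E i (2 * j + 1))\<^sup>2)))"
    by (intro sum_mono) (simp add: mult.left_commute[of "a\<^sup>2"])
  then show ?thesis unfolding wsum_left sum_distrib_left[of "a\<^sup>2"] .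
qed

end

section \<open>Algebra of the constitutive law\<close>

definition compliance :: "real \<Rightarrow> real \<Rightarrow> real \<Rightarrow> real \<Rightarrow> real" where
  "compliance lam mu p q = 1 / (2 * mu) * (p - lam / (2 * lam + 2 * mu) * (p + q))"

lemma compliance_diff:
  "compliance lam mu (p - p') (q - q') = compliance lam mu p q - compliance lam mu p' q'"
proof -
  have "(p - p') - c * ((p - p') + (q - q')) = (p - c * (p + q)) - (p' - c * (p' + q'))" for c :: real
    by (simp add: algebra_simps)
  then show ?thesis unfolding compliance_def by (simp only: right_diff_distrib[of "1 / (2 * mu)"])
qed

text \<open>The second normal strain is \<open>compliance\<close> with its stress arguments
  exchanged. The resulting quadratic form has the eigenvalue \<open>1 / (2 * (lam + mu))\<close> on
  \<open>p = q\<close> and the larger \<open>1 / (2 * mu)\<close> on \<open>p = - q\<close>; the gap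
  between form and lower bound is therefore a multiple of \<open>(p - q)\<^sup>2\<close>.\<close>

lemma compliance_coercive:
  assumes "lam > 0" "mu > 0"
  shows "(p\<^sup>2 + q\<^sup>2) / (2 * (lam + mu)) \<le> p * compliance lam mu p q + q * compliance lam mu q p"
proof -
  have "p * compliance lam mu p q + q * compliance lam mu q p - (p\<^sup>2 + q\<^sup>2) / (2 * (lam + mu))
      = lam / (4 * mu * (lam + mu)) * (p - q)\<^sup>2"
    using assms unfolding compliance_def
    by (simp add: divide_simps) (simp add: algebra_simps power2_eq_square)
  also have "\<dots> \<ge> 0" using assms by simp
  finally show ?thesis by simp
qed

lemma abs_compliance_le:
  assumes "lam > 0" "mu > 0"
  shows "\<bar>compliance lam mu p q\<bar> \<le> (\<bar>p\<bar> + \<bar>q\<bar>) / (2 * mu)"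
proof -
  define c where "c = lam / (2 * lam + 2 * mu)"
  have c: "0 \<le> c" "c \<le> 1" using assms by (auto simp: c_def)
  have "\<bar>p - c * (p + q)\<bar> = \<bar>(1 - c) * p - c * q\<bar>" by (simp add: algebra_simps)
  also have "\<dots> \<le> \<bar>(1 - c) * p\<bar> + \<bar>c * q\<bar>" by (rule abs_triangle_ineq4)
  also have "\<dots> \<le> 1 * \<bar>p\<bar> + 1 * \<bar>q\<bar>"
    unfolding abs_mult using c by (intro add_mono mult_right_mono) auto
  finally show ?thesis
    unfolding compliance_def c_def[symmetric] using assms by (simp add: abs_mult divide_right_mono)
qed

lemma compliance_square_le:
  assumes "lam > 0" "mu > 0"
  shows "(compliance lam mu p q)\<^sup>2 \<le> (p\<^sup>2 + q\<^sup>2) / (2 * mu\<^sup>2)"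
proof -
  have "(compliance lam mu p q)\<^sup>2 \<le> ((\<bar>p\<bar> + \<bar>q\<bar>) / (2 * mu))\<^sup>2"
    using abs_compliance_le[OF assms, of p q] by (intro power2_le_iff_abs_le[THEN iffD2]) (use assms in auto)
  also have "\<dots> = (\<bar>p\<bar> + \<bar>q\<bar>)\<^sup>2 / (4 * mu\<^sup>2)" by (simp add: power_divide power_mult_distrib)
  also have "\<dots> \<le> 2 * (p\<^sup>2 + q\<^sup>2) / (4 * mu\<^sup>2)"
  proof (rule divide_right_mono)
    have "0 \<le> (\<bar>p\<bar> - \<bar>q\<bar>)\<^sup>2" by simp
    then show "(\<bar>p\<bar> + \<bar>q\<bar>)\<^sup>2 \<le> 2 * (p\<^sup>2 + q\<^sup>2)" by (simp add: power2_eq_square algebra_simps)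
  qed simp
  also have "2 * z / (4 * m) = z / (2 * m)" for z m :: real by simp
  finally show ?thesis .
qed

text \<open>The second factor will be a residual with a uniform bound; the weight \<open>c\<close>
  fixes how much of the squared error has to be absorbed.\<close>

lemma Young_ineq:
  fixes x y c \<rho> :: real
  assumes "c > 0" "\<bar>y\<bar> \<le> \<rho>"
  shows "x * y \<le> c * x\<^sup>2 + \<rho>\<^sup>2 / (4 * c)"
proof -
  have "0 \<le> (2 * c * x - y)\<^sup>2 / (4 * c)" using assms by simp
  also have "\<dots> = c * x\<^sup>2 - x * y + y\<^sup>2 / (4 * c)"
    using assms by (simp add: power2_eq_square field_simps)
  finally have "x * y \<le> c * x\<^sup>2 + y\<^sup>2 / (4 * c)" by simp
  also have "y\<^sup>2 / (4 * c) \<le> \<rho>\<^sup>2 / (4 * c)"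
    using assms abs_le_square_iff[of y \<rho>] by (intro divide_right_mono) auto
  finally show ?thesis by simp
qed

section \<open>Stability\<close>

lemma normM_wsum: "normM xs nx ys ny \<phi> =
    sqrt (wsum {..<nx} {..<ny} (hh xs) (hh ys) (\<lambda>i j. (\<phi> (2 * i + 1) (2 * j + 1))\<^sup>2))"
  and normT_wsum: "normT xs nx ys ny \<phi> =
    sqrt (wsum {..nx} {..ny} (hn xs nx) (hn ys ny) (\<lambda>i j. (\<phi> (2 * i) (2 * j))\<^sup>2))"
  and normTM_wsum: "normTM xs nx ys ny \<phi> =
    sqrt (wsum {1..<nx} {..<ny} (hn xs nx) (hh ys) (\<lambda>i j. (\<phi> (2 * i) (2 * j + 1))\<^sup>2))"
  and normMT_wsum: "normMT xs nx ys ny \<phi> =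
    sqrt (wsum {..<nx} {1..<ny} (hh xs) (hn ys ny) (\<lambda>i j. (\<phi> (2 * i + 1) (2 * j))\<^sup>2))"
  by (simp_all add: normM_def normT_def normTM_def normMT_def wsum_def)

text \<open>By linearity the differences between scheme solution and interpolants satisfy the scheme
  up to residuals, which is the situation treated here. \<open>B\<close> is chosen before the grid
  and hence is uniform under refinement.\<close>

lemma MACE_stability:
  fixes a b lam mu :: real
  assumes pos: "a > 0" "b > 0" "lam > 0" "mu > 0"
  shows "\<exists>B>0. \<forall>nx xs ny ys Ex Ey E11 E22 E12 \<rho>.
    is_grid a nx xs \<longrightarrow> is_grid b ny ys \<longrightarrow> \<rho> \<ge> 0 \<longrightarrow>
    (\<forall>j<ny. Ex 0 (2*j+1) = 0 \<and> Ex (2*nx) (2*j+1) = 0) \<longrightarrow>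
    (\<forall>i\<le>nx. Ex (2*i) 0 = 0 \<and> Ex (2*i) (2*ny) = 0) \<longrightarrow>
    (\<forall>i<nx. Ey (2*i+1) 0 = 0 \<and> Ey (2*i+1) (2*ny) = 0) \<longrightarrow>
    (\<forall>j\<le>ny. Ey 0 (2*j) = 0 \<and> Ey (2*nx) (2*j) = 0) \<longrightarrow>
    (\<forall>i<nx. \<forall>j<ny. \<bar>compliance lam mu (E11 (2*i+1) (2*j+1)) (E22 (2*i+1) (2*j+1)) - dX xs Ex i (2*j+1)\<bar> \<le> \<rho>
      \<and> \<bar>compliance lam mu (E22 (2*i+1) (2*j+1)) (E11 (2*i+1) (2*j+1)) - dY ys Ey (2*i+1) j\<bar> \<le> \<rho>) \<longrightarrow>
    (\<forall>i\<le>nx. \<forall>j\<le>ny. \<bar>E12 (2*i) (2*j) / mu - (DY ys ny Ex (2*i) j + DX xs nx Ey i (2*j))\<bar> \<le> \<rho>) \<longrightarrow>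
    (\<forall>i\<in>{1..<nx}. \<forall>j<ny. \<bar>DX xs nx E11 i (2*j+1) + dY ys E12 (2*i) j\<bar> \<le> \<rho>) \<longrightarrow>
    (\<forall>i<nx. \<forall>j\<in>{1..<ny}. \<bar>dX xs E12 i (2*j) + DY ys ny E22 (2*i+1) j\<bar> \<le> \<rho>) \<longrightarrow>
    normTM xs nx ys ny Ex \<le> B * \<rho> \<and> normMT xs nx ys ny Ey \<le> B * \<rho> \<and> normT xs nx ys ny E12 \<le> B * \<rho>
      \<and> normM xs nx ys ny E11 \<le> B * \<rho> \<and> normM xs nx ys ny E22 \<le> B * \<rho>"
proof -
  define c1 where "c1 = 1 / (2 * (lam + mu))"
  \<comment> \<open>By the bound \<open>UV\<close> below, this weight makes the displacement terms
    cost only a quarter of the diagonal stress energy.\<close>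
  define \<epsilon> where "\<epsilon> = c1 * mu\<^sup>2 / (4 * (a\<^sup>2 + b\<^sup>2))"
  \<comment> \<open>\<open>G\<close> gathers the coefficients of \<open>\<rho>\<^sup>2\<close> left
    by Young's inequality and by \<open>UV\<close>; \<open>a * b\<close> is the area obtained by
    summing a constant.\<close>
  define G where "G = a * b * (2 / c1 + mu / 2 + c1 * mu\<^sup>2 / 2 + 1 / (2 * \<epsilon>))"
  \<comment> \<open>The summands bound the squared norms of the diagonal stresses, of the shear
    stress and of the displacements; the norms themselves get \<open>sqrt B\<close>.\<close>
  define B where "B = 2 * G / c1 + 2 * mu * G + (a\<^sup>2 + b\<^sup>2) * (2 * G / (c1 * mu\<^sup>2) + 2 * a * b)"
  have c1: "c1 > 0" and ab2: "a\<^sup>2 + b\<^sup>2 > 0" using pos by (auto simp: c1_def intro!: add_pos_pos)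
  then have eps: "\<epsilon> > 0" using pos by (simp add: \<epsilon>_def)
  have G: "G > 0" using pos c1 eps by (auto simp: G_def intro!: mult_pos_pos add_pos_pos)
  have Bparts: "2 * G / c1 > 0" "2 * mu * G > 0" "(a\<^sup>2 + b\<^sup>2) * (2 * G / (c1 * mu\<^sup>2) + 2 * a * b) > 0"
    using pos c1 ab2 G by (auto intro!: mult_pos_pos add_pos_pos divide_pos_pos)
  then have B: "B > 0" unfolding B_def by linarith
  show ?thesis
  proof (intro exI[of _ "sqrt B"] conjI allI impI)
    show "sqrt B > 0" using B by simp
    fix nx xs ny ys Ex Ey E11 E22 E12 and \<rho> :: real
    assume grids: "is_grid a nx xs" "is_grid b ny ys" and \<rho>: "\<rho> \<ge> 0"
      and Ex1: "\<forall>j<ny. Ex 0 (2*j+1) = 0 \<and> Ex (2*nx) (2*j+1) = (0::real)"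
      and Ex2: "\<forall>i\<le>nx. Ex (2*i) 0 = 0 \<and> Ex (2*i) (2*ny) = 0"
      and Ey1: "\<forall>i<nx. Ey (2*i+1) 0 = 0 \<and> Ey (2*i+1) (2*ny) = (0::real)"
      and Ey2: "\<forall>j\<le>ny. Ey 0 (2*j) = 0 \<and> Ey (2*nx) (2*j) = 0"
      and R1: "\<forall>i<nx. \<forall>j<ny.
        \<bar>compliance lam mu (E11 (2*i+1) (2*j+1)) (E22 (2*i+1) (2*j+1)) - dX xs Ex i (2*j+1)\<bar> \<le> \<rho>
        \<and> \<bar>compliance lam mu (E22 (2*i+1) (2*j+1)) (E11 (2*i+1) (2*j+1)) - dY ys Ey (2*i+1) j\<bar> \<le> \<rho>"
      and R12: "\<forall>i\<le>nx. \<forall>j\<le>ny. \<bar>E12 (2*i) (2*j) / mu - (DY ys ny Ex (2*i) j + DX xs nx Ey i (2*j))\<bar> \<le> \<rho>"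
      and Rx: "\<forall>i\<in>{1..<nx}. \<forall>j<ny. \<bar>DX xs nx E11 i (2*j+1) + dY ys E12 (2*i) j\<bar> \<le> \<rho>"
      and Ry: "\<forall>i<nx. \<forall>j\<in>{1..<ny}. \<bar>dX xs E12 i (2*j) + DY ys ny E22 (2*i+1) j\<bar> \<le> \<rho>"
    define e11 e22 where "e11 = (\<lambda>i j. E11 (2*i+1) (2*j+1))" and "e22 = (\<lambda>i j. E22 (2*i+1) (2*j+1))"
    define e12 where "e12 = (\<lambda>i j. E12 (2*i) (2*j))"
    define ex ey where "ex = (\<lambda>i j. Ex (2*i) (2*j+1))" and "ey = (\<lambda>i j. Ey (2*i+1) (2*j))"
    define p q s where "p = (\<lambda>i j. dX xs Ex i (2*j+1))" and "q = (\<lambda>i j. dY ys Ey (2*i+1) j)"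
      and "s = (\<lambda>i j. DY ys ny Ex (2*i) j + DX xs nx Ey i (2*j))"
    define rx ry where "rx = (\<lambda>i j. DX xs nx E11 i (2*j+1) + dY ys E12 (2*i) j)"
      and "ry = (\<lambda>i j. dX xs E12 i (2*j) + DY ys ny E22 (2*i+1) j)"
    define M where "M = wsum {..<nx} {..<ny} (hh xs) (hh ys)"
    define T where "T = wsum {..nx} {..ny} (hn xs nx) (hn ys ny)"
    define TM where "TM = wsum {1..<nx} {..<ny} (hn xs nx) (hh ys)"
    define MT where "MT = wsum {..<nx} {1..<ny} (hh xs) (hn ys ny)"
    have nx: "nx > 0" and ny: "ny > 0"
      using grid_card_pos[OF pos(1) grids(1)] grid_card_pos[OF pos(2) grids(2)] .
    note hpos = hh_pos[OF grids(1)] hh_pos[OF grids(2)] hn_pos[OF grids(1) nx] hn_pos[OF grids(2) ny]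
    have M_mono: "M f \<le> M g" if "\<And>i j. i < nx \<Longrightarrow> j < ny \<Longrightarrow> f i j \<le> g i j" for f g
      unfolding M_def using that hpos by (intro wsum_mono) (auto intro: less_imp_le)
    have T_mono: "T f \<le> T g" if "\<And>i j. i \<le> nx \<Longrightarrow> j \<le> ny \<Longrightarrow> f i j \<le> g i j" for f g
      unfolding T_def using that hpos by (intro wsum_mono) (auto intro: less_imp_le)
    have TM_mono: "TM f \<le> TM g" if "\<And>i j. i \<in> {1..<nx} \<Longrightarrow> j < ny \<Longrightarrow> f i j \<le> g i j" for f g
      unfolding TM_def using that hpos by (intro wsum_mono) (auto intro: less_imp_le)
    have MT_mono: "MT f \<le> MT g" if "\<And>i j. i < nx \<Longrightarrow> j \<in> {1..<ny} \<Longrightarrow> f i j \<le> g i j" for f g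
      unfolding MT_def using that hpos by (intro wsum_mono) (auto intro: less_imp_le)
    have lin: "M (\<lambda>i j. f i j + g i j) = M f + M g" "T (\<lambda>i j. f i j + g i j) = T f + T g"
      "TM (\<lambda>i j. f i j + g i j) = TM f + TM g" "MT (\<lambda>i j. f i j + g i j) = MT f + MT g"
      "M (\<lambda>i j. c * f i j) = c * M f" "T (\<lambda>i j. c * f i j) = c * T f"
      "TM (\<lambda>i j. c * f i j) = c * TM f" "MT (\<lambda>i j. c * f i j) = c * MT f" for f g c
      by (simp_all add: M_def T_def TM_def MT_def wsum_add wsum_cmult)
    have Mc: "M (\<lambda>i j. c) = c * (a * b)" and Tc: "T (\<lambda>i j. c) = c * (a * b)" for c
      unfolding M_def T_def wsum_const
      by (simp_all add: sum_hh[OF pos(1) grids(1)] sum_hh[OF pos(2) grids(2)] sum_hn[OF pos(1) grids(1)] sum_hn[OF pos(2) grids(2)])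
    have TMc: "TM (\<lambda>i j. c) \<le> c * (a * b)" and MTc: "MT (\<lambda>i j. c) \<le> c * (a * b)" if "c \<ge> 0" for c
      unfolding TM_def MT_def wsum_const using that hpos pos
        sum_hh[OF pos(1) grids(1)] sum_hh[OF pos(2) grids(2)]
        sum_hn_interior[OF pos(1) grids(1)] sum_hn_interior[OF pos(2) grids(2)]
      by (auto intro!: mult_left_mono mult_mono)

    have weak_x: "TM (\<lambda>i j. rx i j * ex i j) = - M (\<lambda>i j. e11 i j * p i j) - T (\<lambda>i j. e12 i j * DY ys ny Ex (2*i) j)"
      using weak_momentum[OF pos(1,2) grids, of Ex E11 E12] Ex1 Ex2
      unfolding TM_def M_def T_def rx_def ex_def e11_def e12_def p_def by blast
    \<comment> \<open>This is the first momentum identity on the transposed grid, with the order of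
      summation swapped back.\<close>
    have weak_y: "MT (\<lambda>i j. ry i j * ey i j) = - M (\<lambda>i j. e22 i j * q i j) - T (\<lambda>i j. e12 i j * DX xs nx Ey i (2*j))"
    proof -
      have 1: "wsum {1..<ny} {..<nx} (hn ys ny) (hh xs) (\<lambda>j i. ry i j * ey i j)
        = - wsum {..<ny} {..<nx} (hh ys) (hh xs) (\<lambda>j i. e22 i j * q i j)
          - wsum {..ny} {..nx} (hn ys ny) (hn xs nx) (\<lambda>j i. e12 i j * DX xs nx Ey i (2*j))"
        using weak_momentum[OF pos(2,1) grids(2,1), of "\<lambda>m k. Ey k m" "\<lambda>m k. E22 k m" "\<lambda>m k. E12 k m"] Ey1 Ey2
        unfolding ry_def ey_def e22_def e12_def q_def
          dY_transpose[of xs "\<lambda>m k. E12 k m"] dY_transpose[of ys Ey] DY_transpose[of ys ny E22]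
          DY_transpose[of xs nx "\<lambda>m k. Ey k m"]
        by (simp add: add.commute)
      then show ?thesis
        unfolding MT_def M_def T_def
        using wsum_swap[of "{1..<ny}" "{..<nx}" "hn ys ny" "hh xs" "\<lambda>i j. ry i j * ey i j"]
          wsum_swap[of "{..<ny}" "{..<nx}" "hh ys" "hh xs" "\<lambda>i j. e22 i j * q i j"]
          wsum_swap[of "{..ny}" "{..nx}" "hn ys ny" "hn xs nx" "\<lambda>i j. e12 i j * DX xs nx Ey i (2*j)"]
        by simp
    qed
    have Pex: "TM (\<lambda>i j. (ex i j)\<^sup>2) \<le> a\<^sup>2 * M (\<lambda>i j. (p i j)\<^sup>2)"
      using wsum_Poincare[OF pos(1,2) grids, of Ex] Ex1
      unfolding TM_def M_def ex_def p_def by blast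
    have Pey: "MT (\<lambda>i j. (ey i j)\<^sup>2) \<le> b\<^sup>2 * M (\<lambda>i j. (q i j)\<^sup>2)"
      using wsum_Poincare[OF pos(2,1) grids(2,1), of "\<lambda>m k. Ey k m"] Ey1
        wsum_swap[of "{1..<ny}" "{..<nx}" "hn ys ny" "hh xs" "\<lambda>i j. (ey i j)\<^sup>2"]
        wsum_swap[of "{..<ny}" "{..<nx}" "hh ys" "hh xs" "\<lambda>i j. (q i j)\<^sup>2"]
      unfolding MT_def M_def ey_def q_def dY_transpose[of ys Ey] by simp

    define X where "X = M (\<lambda>i j. (e11 i j)\<^sup>2) + M (\<lambda>i j. (e22 i j)\<^sup>2)"
    define Y where "Y = T (\<lambda>i j. (e12 i j)\<^sup>2)"
    define U where "U = TM (\<lambda>i j. (ex i j)\<^sup>2)"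
    define V where "V = MT (\<lambda>i j. (ey i j)\<^sup>2)"
    let ?A1 = "\<lambda>i j. compliance lam mu (e11 i j) (e22 i j)"
    let ?A2 = "\<lambda>i j. compliance lam mu (e22 i j) (e11 i j)"
    have res: "\<bar>?A1 i j - p i j\<bar> \<le> \<rho>" "\<bar>?A2 i j - q i j\<bar> \<le> \<rho>" if "i < nx" "j < ny" for i j
      using R1 that unfolding e11_def e22_def p_def q_def by auto
    have res12: "\<bar>e12 i j / mu - s i j\<bar> \<le> \<rho>" if "i \<le> nx" "j \<le> ny" for i j
      using R12 that unfolding e12_def s_def by auto
    have resx: "\<bar>- rx i j\<bar> \<le> \<rho>" if "i \<in> {1..<nx}" "j < ny" for i j
      unfolding abs_minus_cancel rx_def using Rx that by blast
    have resy: "\<bar>- ry i j\<bar> \<le> \<rho>" if "i < nx" "j \<in> {1..<ny}" for i j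
      unfolding abs_minus_cancel ry_def using Ry that by blast

    have UV: "U + V \<le> (a\<^sup>2 + b\<^sup>2) * (X / mu\<^sup>2 + 2 * \<rho>\<^sup>2 * (a * b))"
    proof -
      have pt: "x\<^sup>2 \<le> (u\<^sup>2 + v\<^sup>2) / mu\<^sup>2 + 2 * \<rho>\<^sup>2" if "\<bar>compliance lam mu u v - x\<bar> \<le> \<rho>" for x u v
      proof -
        let ?A = "compliance lam mu u v"
        have "(?A - x)\<^sup>2 \<le> \<rho>\<^sup>2" using that \<rho> by (simp add: power2_le_iff_abs_le)
        moreover have "0 \<le> (2 * ?A - x)\<^sup>2" by simp
        then have "x\<^sup>2 \<le> 2 * ?A\<^sup>2 + 2 * (?A - x)\<^sup>2" by (simp add: power2_eq_square algebra_simps)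
        moreover have "2 * ?A\<^sup>2 \<le> (u\<^sup>2 + v\<^sup>2) / mu\<^sup>2"
          using compliance_square_le[OF pos(3,4), of u v] by simp
        ultimately show ?thesis by linarith
      qed
      have "M (\<lambda>i j. (p i j)\<^sup>2) \<le> M (\<lambda>i j. 1 / mu\<^sup>2 * ((e11 i j)\<^sup>2 + (e22 i j)\<^sup>2) + 2 * \<rho>\<^sup>2)"
        using pt[OF res(1)] by (intro M_mono) simp
      then have "M (\<lambda>i j. (p i j)\<^sup>2) \<le> X / mu\<^sup>2 + 2 * \<rho>\<^sup>2 * (a * b)" unfolding lin Mc X_def by simp
      then have 1: "a\<^sup>2 * M (\<lambda>i j. (p i j)\<^sup>2) \<le> a\<^sup>2 * (X / mu\<^sup>2 + 2 * \<rho>\<^sup>2 * (a * b))" by (rule mult_left_mono) simp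
      have "M (\<lambda>i j. (q i j)\<^sup>2) \<le> M (\<lambda>i j. 1 / mu\<^sup>2 * ((e22 i j)\<^sup>2 + (e11 i j)\<^sup>2) + 2 * \<rho>\<^sup>2)"
        using pt[OF res(2)] by (intro M_mono) simp
      then have "M (\<lambda>i j. (q i j)\<^sup>2) \<le> X / mu\<^sup>2 + 2 * \<rho>\<^sup>2 * (a * b)" unfolding lin Mc X_def by (simp add: add.commute)
      then have 2: "b\<^sup>2 * M (\<lambda>i j. (q i j)\<^sup>2) \<le> b\<^sup>2 * (X / mu\<^sup>2 + 2 * \<rho>\<^sup>2 * (a * b))" by (rule mult_left_mono) simp
      show ?thesis using Pex Pey 1 2 unfolding U_def V_def distrib_right[of "a\<^sup>2"] by linarith
    qed

    \<comment> \<open>\<open>weak_x\<close> and \<open>weak_y\<close> turn the work of the stress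
      errors on the discrete strains into work of the momentum residuals on the displacement errors.
      The right-hand side is therefore exactly the compliance energy, which is coercive.\<close>
    have energy: "c1 * X + 1 / mu * Y \<le> M (\<lambda>i j. e11 i j * (?A1 i j - p i j)) + M (\<lambda>i j. e22 i j * (?A2 i j - q i j))
        + T (\<lambda>i j. e12 i j * (e12 i j / mu - s i j)) + TM (\<lambda>i j. ex i j * (- rx i j)) + MT (\<lambda>i j. ey i j * (- ry i j))"
    proof -
      have "c1 * X = M (\<lambda>i j. c1 * ((e11 i j)\<^sup>2 + (e22 i j)\<^sup>2))" unfolding lin X_def ..
      also have "\<dots> \<le> M (\<lambda>i j. e11 i j * ?A1 i j + e22 i j * ?A2 i j)"
        using compliance_coercive[OF pos(3,4)] by (intro M_mono) (simp add: c1_def)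
      finally have 1: "c1 * X \<le> M (\<lambda>i j. e11 i j * ?A1 i j) + M (\<lambda>i j. e22 i j * ?A2 i j)" unfolding lin .
      have 2: "M (\<lambda>i j. f i j * (g i j - h i j)) = M (\<lambda>i j. f i j * g i j) + - 1 * M (\<lambda>i j. f i j * h i j)" for f g h
        unfolding lin[symmetric] by (simp add: right_diff_distrib)
      have 3: "T (\<lambda>i j. e12 i j * (e12 i j / mu - s i j)) = 1 / mu * Y
          + (- 1 * T (\<lambda>i j. e12 i j * DY ys ny Ex (2*i) j) + - 1 * T (\<lambda>i j. e12 i j * DX xs nx Ey i (2*j)))"
        unfolding lin[symmetric] Y_def s_def by (simp add: algebra_simps power2_eq_square)
      have 4: "TM (\<lambda>i j. ex i j * (- rx i j)) = - 1 * TM (\<lambda>i j. rx i j * ex i j)"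
        "MT (\<lambda>i j. ey i j * (- ry i j)) = - 1 * MT (\<lambda>i j. ry i j * ey i j)"
        unfolding lin[symmetric] by (simp_all add: mult.commute)
      show ?thesis using 1 weak_x weak_y unfolding 2 3 4 by linarith
    qed
    have Y1: "M (\<lambda>i j. e11 i j * (?A1 i j - p i j)) \<le> c1 / 4 * M (\<lambda>i j. (e11 i j)\<^sup>2) + \<rho>\<^sup>2 / (4 * (c1 / 4)) * (a * b)"
      unfolding Mc[symmetric] lin[symmetric] using c1 by (intro M_mono Young_ineq res) auto
    have Y2: "M (\<lambda>i j. e22 i j * (?A2 i j - q i j)) \<le> c1 / 4 * M (\<lambda>i j. (e22 i j)\<^sup>2) + \<rho>\<^sup>2 / (4 * (c1 / 4)) * (a * b)"
      unfolding Mc[symmetric] lin[symmetric] using c1 by (intro M_mono Young_ineq res) auto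
    have Y3: "T (\<lambda>i j. e12 i j * (e12 i j / mu - s i j)) \<le> 1 / (2 * mu) * Y + \<rho>\<^sup>2 / (4 * (1 / (2 * mu))) * (a * b)"
      unfolding Tc[symmetric] lin[symmetric] Y_def using pos by (intro T_mono Young_ineq res12) auto
    have "TM (\<lambda>i j. ex i j * (- rx i j)) \<le> TM (\<lambda>i j. \<epsilon> * (ex i j)\<^sup>2 + \<rho>\<^sup>2 / (4 * \<epsilon>))"
      using eps by (intro TM_mono Young_ineq resx)
    then have Y4: "TM (\<lambda>i j. ex i j * (- rx i j)) \<le> \<epsilon> * U + \<rho>\<^sup>2 / (4 * \<epsilon>) * (a * b)"
      using TMc[of "\<rho>\<^sup>2 / (4 * \<epsilon>)"] eps unfolding lin U_def by simp
    have "MT (\<lambda>i j. ey i j * (- ry i j)) \<le> MT (\<lambda>i j. \<epsilon> * (ey i j)\<^sup>2 + \<rho>\<^sup>2 / (4 * \<epsilon>))"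
      using eps by (intro MT_mono Young_ineq resy)
    then have Y5: "MT (\<lambda>i j. ey i j * (- ry i j)) \<le> \<epsilon> * V + \<rho>\<^sup>2 / (4 * \<epsilon>) * (a * b)"
      using MTc[of "\<rho>\<^sup>2 / (4 * \<epsilon>)"] eps unfolding lin V_def by simp
    have cancel: "c / (4 * k) * k = c / 4" if "k > 0" for c k :: real using that by simp
    have "\<epsilon> * (U + V) \<le> \<epsilon> * ((a\<^sup>2 + b\<^sup>2) * (X / mu\<^sup>2 + 2 * \<rho>\<^sup>2 * (a * b)))"
      using UV eps by (intro mult_left_mono) auto
    also have "\<dots> = (\<epsilon> * (a\<^sup>2 + b\<^sup>2)) * (X / mu\<^sup>2 + 2 * \<rho>\<^sup>2 * (a * b))" by simp
    also have "\<epsilon> * (a\<^sup>2 + b\<^sup>2) = c1 * mu\<^sup>2 / 4" unfolding \<epsilon>_def by (rule cancel[OF ab2])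
    also have "c1 * mu\<^sup>2 / 4 * (X / mu\<^sup>2 + 2 * \<rho>\<^sup>2 * (a * b)) = c1 / 4 * X + c1 * mu\<^sup>2 / 2 * \<rho>\<^sup>2 * (a * b)"
      using pos by (simp add: field_simps)
    finally have Y6: "\<epsilon> * U + \<epsilon> * V \<le> c1 / 4 * X + c1 * mu\<^sup>2 / 2 * \<rho>\<^sup>2 * (a * b)" by (simp add: distrib_left)
    define k1 k2 k3 k4 where "k1 = \<rho>\<^sup>2 / (4 * (c1 / 4)) * (a * b)" and "k2 = \<rho>\<^sup>2 / (4 * (1 / (2 * mu))) * (a * b)"
      and "k3 = \<rho>\<^sup>2 / (4 * \<epsilon>) * (a * b)" and "k4 = c1 * mu\<^sup>2 / 2 * \<rho>\<^sup>2 * (a * b)"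
    have X_split: "c1 / 4 * M (\<lambda>i j. (e11 i j)\<^sup>2) + c1 / 4 * M (\<lambda>i j. (e22 i j)\<^sup>2) = c1 / 4 * X"
      unfolding X_def by (rule distrib_left[symmetric])
    \<comment> \<open>Of the diagonal energy, one quarter pays for the constitutive residuals and
      one for the displacement terms; of the shear energy, one half pays for the shear residual.
      Half of each remains on the left.\<close>
    have "c1 * X + 1 / mu * Y \<le> c1 / 4 * X + 1 / (2 * mu) * Y + c1 / 4 * X
      + (2 * k1 + k2 + 2 * k3 + k4)"
      using energy Y1 Y2 Y3 Y4 Y5 Y6 X_split
      unfolding k1_def[symmetric] k2_def[symmetric] k3_def[symmetric] k4_def[symmetric] by linarith
    also have "2 * k1 + k2 + 2 * k3 + k4 = G * \<rho>\<^sup>2"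
      using c1 eps pos by (simp add: k1_def k2_def k3_def k4_def G_def field_simps)
    finally have "c1 * X + 1 / mu * Y \<le> c1 / 4 * X + 1 / (2 * mu) * Y + c1 / 4 * X + G * \<rho>\<^sup>2" .
    moreover have "1 / mu * Y = 1 / (2 * mu) * Y + 1 / (2 * mu) * Y" "c1 * X = c1 / 4 * X + c1 / 4 * X + c1 / 2 * X"
      by (simp_all add: field_simps)
    ultimately have main: "c1 / 2 * X + 1 / (2 * mu) * Y \<le> G * \<rho>\<^sup>2" by linarith
    have nonneg: "M (\<lambda>i j. (f i j)\<^sup>2) \<ge> 0" "T (\<lambda>i j. (f i j)\<^sup>2) \<ge> 0" "TM (\<lambda>i j. (f i j)\<^sup>2) \<ge> 0" "MT (\<lambda>i j. (f i j)\<^sup>2) \<ge> 0" for f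
      using M_mono[of "\<lambda>i j. 0" "\<lambda>i j. (f i j)\<^sup>2"] T_mono[of "\<lambda>i j. 0" "\<lambda>i j. (f i j)\<^sup>2"]
        TM_mono[of "\<lambda>i j. 0" "\<lambda>i j. (f i j)\<^sup>2"] MT_mono[of "\<lambda>i j. 0" "\<lambda>i j. (f i j)\<^sup>2"]
      by (simp_all add: M_def T_def TM_def MT_def wsum_const)
    have X0: "X \<ge> 0" and Y0: "Y \<ge> 0" and UV0: "U \<ge> 0" "V \<ge> 0"
      unfolding X_def Y_def U_def V_def by (auto intro!: nonneg add_nonneg_nonneg)
    have "c1 / 2 * X \<le> G * \<rho>\<^sup>2" using main Y0 pos by (smt (verit) divide_pos_pos mult_nonneg_nonneg)
    then have Xle: "X \<le> 2 * G / c1 * \<rho>\<^sup>2" using c1 by (simp add: field_simps)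
    have "1 / (2 * mu) * Y \<le> G * \<rho>\<^sup>2" using main X0 c1 by (smt (verit) divide_pos_pos mult_nonneg_nonneg)
    then have Yle: "Y \<le> 2 * mu * G * \<rho>\<^sup>2" using pos by (simp add: field_simps)
    have "X / mu\<^sup>2 \<le> 2 * G / c1 * \<rho>\<^sup>2 / mu\<^sup>2" using Xle by (rule divide_right_mono) simp
    then have "U + V \<le> (a\<^sup>2 + b\<^sup>2) * (2 * G / c1 * \<rho>\<^sup>2 / mu\<^sup>2 + 2 * \<rho>\<^sup>2 * (a * b))"
      using ab2 by (intro order_trans[OF UV] mult_left_mono add_right_mono) auto
    also have "\<dots> = (a\<^sup>2 + b\<^sup>2) * (2 * G / (c1 * mu\<^sup>2) + 2 * a * b) * \<rho>\<^sup>2" by (simp add: algebra_simps)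
    finally have UVle: "U + V \<le> (a\<^sup>2 + b\<^sup>2) * (2 * G / (c1 * mu\<^sup>2) + 2 * a * b) * \<rho>\<^sup>2" .
    have part: "z \<le> B * \<rho>\<^sup>2" if "z \<le> k * \<rho>\<^sup>2" "k \<le> B" for z k
      using that mult_right_mono[of k B "\<rho>\<^sup>2"] by simp
    have sq: "sqrt z \<le> sqrt B * \<rho>" if "z \<le> B * \<rho>\<^sup>2" for z
      using real_sqrt_le_mono[OF that] \<rho> by (simp add: real_sqrt_mult)
    have "X \<le> B * \<rho>\<^sup>2" "Y \<le> B * \<rho>\<^sup>2" "U + V \<le> B * \<rho>\<^sup>2"
      using part[OF Xle] part[OF Yle] part[OF UVle] Bparts unfolding B_def by simp_all
    moreover have "M (\<lambda>i j. (e11 i j)\<^sup>2) \<le> X" "M (\<lambda>i j. (e22 i j)\<^sup>2) \<le> X" "U \<le> U + V" "V \<le> U + V"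
      unfolding X_def using nonneg UV0 by auto
    ultimately have fin: "M (\<lambda>i j. (e11 i j)\<^sup>2) \<le> B * \<rho>\<^sup>2" "M (\<lambda>i j. (e22 i j)\<^sup>2) \<le> B * \<rho>\<^sup>2"
      "Y \<le> B * \<rho>\<^sup>2" "U \<le> B * \<rho>\<^sup>2" "V \<le> B * \<rho>\<^sup>2" by linarith+
    show "normTM xs nx ys ny Ex \<le> sqrt B * \<rho>" "normMT xs nx ys ny Ey \<le> sqrt B * \<rho>"
      "normT xs nx ys ny E12 \<le> sqrt B * \<rho>" "normM xs nx ys ny E11 \<le> sqrt B * \<rho>" "normM xs nx ys ny E22 \<le> sqrt B * \<rho>"
      using sq[OF fin(1)] sq[OF fin(2)] sq[OF fin(3)] sq[OF fin(4)] sq[OF fin(5)]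
      unfolding normM_wsum normT_wsum normTM_wsum normMT_wsum M_def Y_def U_def V_def T_def TM_def MT_def
        e11_def e22_def e12_def ex_def ey_def by simp_all
  qed
qed

section \<open>The error estimate\<close>

text \<open>Here the interpolant is set to the exact boundary value 0 on the two sides where \<^const>\<open>tux\<close> has
  no natural correction; the half-cell quotients \<open>D\<^sub>y\<close> there then stay second order accurate.\<close>

definition dux :: "(nat \<Rightarrow> real) \<Rightarrow> nat \<Rightarrow> (nat \<Rightarrow> real) \<Rightarrow> (real \<Rightarrow> real \<Rightarrow> real) \<Rightarrow> nat \<Rightarrow> nat \<Rightarrow> real" where
  "dux xs ny ys u k m = (if m = 0 \<or> m = 2 * ny then 0 else tux xs ys u k m)"

definition duy :: "nat \<Rightarrow> (nat \<Rightarrow> real) \<Rightarrow> (nat \<Rightarrow> real) \<Rightarrow> (real \<Rightarrow> real \<Rightarrow> real) \<Rightarrow> nat \<Rightarrow> nat \<Rightarrow> real" where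
  "duy nx xs ys u k m = (if k = 0 \<or> k = 2 * nx then 0 else tuy xs ys u k m)"

lemma duy_transpose: "duy nx xs ys u k m = dux ys nx xs (\<lambda>x y. u y x) m k"
  by (simp add: duy_def dux_def tux_def tuy_def Let_def pdx_transpose[of u] pdy_transpose[of u]
      pdy_transpose[of "pdx u"])

lemma tsig_diag_transpose: "tsig_diag xs ys s k m = tsig_diag ys xs (\<lambda>x y. s y x) m k"
  by (simp add: tsig_diag_def Let_def pdx_transpose[of s] pdy_transpose[of s]
      pdx_transpose[of "pdy s"] pdy_transpose[of "pdx s"])

lemma tsig_off_transpose: "tsig_off xs ys s k m = tsig_off ys xs (\<lambda>x y. s y x) m k"
  by (simp add: tsig_off_def)

lemma odd_neq_even: "2 * j + 1 \<noteq> 2 * (k::nat)"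
  by presburger

lemma dX_diff: "dX xs (\<lambda>k m. \<phi> k m - \<psi> k m) i m = dX xs \<phi> i m - dX xs \<psi> i m"
  by (simp add: dX_def diff_divide_distrib)

lemma dY_diff: "dY ys (\<lambda>k m. \<phi> k m - \<psi> k m) k j = dY ys \<phi> k j - dY ys \<psi> k j"
  by (simp add: dY_def diff_divide_distrib)

lemma DX_diff: "DX xs n (\<lambda>k m. \<phi> k m - \<psi> k m) i m = DX xs n \<phi> i m - DX xs n \<psi> i m"
  by (simp add: DX_def diff_divide_distrib)

lemma DY_diff: "DY ys n (\<lambda>k m. \<phi> k m - \<psi> k m) k j = DY ys n \<phi> k j - DY ys n \<psi> k j"
  by (simp add: DY_def diff_divide_distrib)

lemma dX_dux: "dX xs (dux xs ny ys u) i (2 * j + 1) = dX xs (tux xs ys u) i (2 * j + 1)"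
  using odd_neq_even[of j ny] by (simp add: dX_def dux_def)

text \<open>Along a vertical side \<open>u\<close> is constantly zero, so its tangential second
  derivative vanishes there too, and the corrected interpolant inherits the boundary
  condition.\<close>

lemma tux_boundary:
  assumes u: "\<And>y. 0 \<le> y \<Longrightarrow> y \<le> b \<Longrightarrow> u (coord xs k) y = 0" and y: "0 < coord ys m" "coord ys m < b"
  shows "tux xs ys u k m = 0"
proof -
  let ?x = "coord xs k"
  have near: "\<forall>\<^sub>F t in nhds y. 0 < t \<and> t < b" if "0 < y" "y < b" for y
    using that eventually_nhds_in_open[of "{0<..<b}" y] by simp
  have 1: "pdy u ?x y = 0" if "0 < y" "y < b" for y
  proof -
    have "\<forall>\<^sub>F t in nhds y. u ?x t = 0" using near[OF that] by eventually_elim (simp add: u)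
    then have "deriv (\<lambda>t. u ?x t) y = deriv (\<lambda>t. 0) y" by (intro deriv_cong_ev) auto
    then show ?thesis by (simp add: pdy_def)
  qed
  have "\<forall>\<^sub>F t in nhds (coord ys m). pdy u ?x t = 0" using near[OF y] by eventually_elim (simp add: 1)
  then have "deriv (\<lambda>t. pdy u ?x t) (coord ys m) = deriv (\<lambda>t. 0) (coord ys m)" by (intro deriv_cong_ev) auto
  then have "pdy (pdy u) ?x (coord ys m) = 0" by (simp add: pdy_def)
  then show ?thesis using u[of "coord ys m"] y by (simp add: tux_def Let_def)
qed

lemma dux_boundary:
  assumes a: "a > 0" and grids: "is_grid a nx xs" "is_grid b ny ys"
    and u: "\<And>y. 0 \<le> y \<Longrightarrow> y \<le> b \<Longrightarrow> u 0 y = 0" "\<And>y. 0 \<le> y \<Longrightarrow> y \<le> b \<Longrightarrow> u a y = 0" and j: "j < ny"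
  shows "dux xs ny ys u 0 (2 * j + 1) = 0" "dux xs ny ys u (2 * nx) (2 * j + 1) = 0"
proof -
  have "coord xs 0 = 0" "coord xs (2 * nx) = a" using grids(1) coord_even[of xs 0] by (auto simp: is_grid_def)
  then show "dux xs ny ys u 0 (2 * j + 1) = 0" "dux xs ny ys u (2 * nx) (2 * j + 1) = 0"
    unfolding dux_def using centre_interior[OF grids(2) j] u
    by (auto intro!: tux_boundary[of b])
qed

text \<open>The scheme imposes the shear law at boundary nodes as well, whereas the differential
  equations are given in the open rectangle. Applying the extension by continuity to the absolute
  defect with bound 0 closes this gap.\<close>

lemma shear_closure:
  assumes "a > 0" "b > 0" and u: "Ck 1 u" "Ck 1 v" and s: "Ck 0 s"
    and pde: "\<And>x y. 0 < x \<Longrightarrow> x < a \<Longrightarrow> 0 < y \<Longrightarrow> y < b \<Longrightarrow> s x y = mu * (pdy u x y + pdx v x y)"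
    and xy: "0 \<le> x" "x \<le> a" "0 \<le> y" "y \<le> b"
  shows "s x y = mu * (pdy u x y + pdx v x y)"
proof -
  let ?g = "\<lambda>x y. \<bar>s x y - mu * (pdy u x y + pdx v x y)\<bar>"
  have "continuous_on UNIV (\<lambda>p::real\<times>real. ?g (fst p) (snd p))"
    using u s by (intro continuous_intros) auto
  from closed_rectangle_extend[of ?g, OF this assms(1,2) _ xy, of 0] pde have "?g x y \<le> 0" by simp
  then show ?thesis by simp
qed

theorem theorem4p3:
  fixes a b lam mu C0 :: real
  assumes "a > 0" and "b > 0" and "lam > 0" and "mu > 0" and "C0 > 0"
  shows "\<exists>C > 0. \<exists>\<delta> > 0. \<forall>nx xs ny ys ux uy s11 s12 s22 fx fy Wx Wy Z11 Z22 Z12.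
     is_grid a nx xs \<and> is_grid b ny ys \<and> regular_grid C0 nx xs ny ys
     \<and> hmax xs nx \<le> \<delta> \<and> hmax ys ny \<le> \<delta>
     \<and> Ck 4 ux \<and> Ck 4 uy \<and> Ck 4 s11 \<and> Ck 4 s12 \<and> Ck 4 s22
     \<and> elasticity_solution a b lam mu ux uy s11 s12 s22 fx fy
     \<and> MACE_solution lam mu nx xs ny ys fx fy Wx Wy Z11 Z22 Z12
     \<longrightarrow>
     (let h = hmax xs nx; l = hmax ys ny;
          N = max (norm3inf a b ux) (norm3inf a b uy)
            + max (norm3inf a b s11) (max (norm3inf a b s12) (norm3inf a b s22))
      in normTM xs nx ys ny (\<lambda>k m. Wx k m - tux xs ys ux k m)
           + normMT xs nx ys ny (\<lambda>k m. Wy k m - tuy xs ys uy k m)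
           \<le> C * (h\<^sup>2 + l\<^sup>2) * N
       \<and> normT xs nx ys ny (\<lambda>k m. Z12 k m - tsig_off xs ys s12 k m)
           \<le> C * mu * (h\<^sup>2 + l\<^sup>2) * N
       \<and> normM xs nx ys ny (\<lambda>k m. Z11 k m - tsig_diag xs ys s11 k m)
           + normM xs nx ys ny (\<lambda>k m. Z22 k m - tsig_diag xs ys s22 k m)
           \<le> C * (lam + mu) * (h\<^sup>2 + l\<^sup>2) * N)"
proof -
  note pos = assms(1-4)
  obtain B where B: "B > 0" and stab: "\<forall>nx xs ny ys Ex Ey E11 E22 E12 \<rho>.
    is_grid a nx xs \<longrightarrow> is_grid b ny ys \<longrightarrow> \<rho> \<ge> 0 \<longrightarrow>
    (\<forall>j<ny. Ex 0 (2*j+1) = 0 \<and> Ex (2*nx) (2*j+1) = 0) \<longrightarrow>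
    (\<forall>i\<le>nx. Ex (2*i) 0 = 0 \<and> Ex (2*i) (2*ny) = 0) \<longrightarrow>
    (\<forall>i<nx. Ey (2*i+1) 0 = 0 \<and> Ey (2*i+1) (2*ny) = 0) \<longrightarrow>
    (\<forall>j\<le>ny. Ey 0 (2*j) = 0 \<and> Ey (2*nx) (2*j) = 0) \<longrightarrow>
    (\<forall>i<nx. \<forall>j<ny. \<bar>compliance lam mu (E11 (2*i+1) (2*j+1)) (E22 (2*i+1) (2*j+1)) - dX xs Ex i (2*j+1)\<bar> \<le> \<rho>
      \<and> \<bar>compliance lam mu (E22 (2*i+1) (2*j+1)) (E11 (2*i+1) (2*j+1)) - dY ys Ey (2*i+1) j\<bar> \<le> \<rho>) \<longrightarrow>
    (\<forall>i\<le>nx. \<forall>j\<le>ny. \<bar>E12 (2*i) (2*j) / mu - (DY ys ny Ex (2*i) j + DX xs nx Ey i (2*j))\<bar> \<le> \<rho>) \<longrightarrow>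
    (\<forall>i\<in>{1..<nx}. \<forall>j<ny. \<bar>DX xs nx E11 i (2*j+1) + dY ys E12 (2*i) j\<bar> \<le> \<rho>) \<longrightarrow>
    (\<forall>i<nx. \<forall>j\<in>{1..<ny}. \<bar>dX xs E12 i (2*j) + DY ys ny E22 (2*i+1) j\<bar> \<le> \<rho>) \<longrightarrow>
    normTM xs nx ys ny Ex \<le> B * \<rho> \<and> normMT xs nx ys ny Ey \<le> B * \<rho> \<and> normT xs nx ys ny E12 \<le> B * \<rho>
      \<and> normM xs nx ys ny E11 \<le> B * \<rho> \<and> normM xs nx ys ny E22 \<le> B * \<rho>"
    using MACE_stability[OF pos] by (elim exE conjE) blast
  \<comment> \<open>The normal strain residuals consist of one truncation error and a compliance
    image of size at most \<open>1 / mu\<close> times it; the shear and momentum residuals are sums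
    of two truncation errors. \<open>Q\<close> covers all of them.\<close>
  define Q where "Q = 2 + 1 / mu"
  have Q: "Q > 0" "Q \<ge> 2" "Q \<ge> 1 / mu + 1" using pos by (auto simp: Q_def intro: add_pos_pos)
  \<comment> \<open>The Lame constants are fixed before \<open>C\<close>. The summands
    \<open>1 / mu\<close> and \<open>1 / (lam + mu)\<close> compensate the factors \<open>mu\<close>
    and \<open>lam + mu\<close> in the stress estimates, and the 2 covers the sums of two
    norms.\<close>
  define C where "C = 2 * B * Q * (1 + 1 / mu + 1 / (lam + mu))"
  have Cs: "2 * (B * Q) \<le> C" "B * Q \<le> C * mu" "2 * (B * Q) \<le> C * (lam + mu)"
  proof -
    have BQ: "B * Q > 0" using B Q by simp
    have "1 \<le> 1 + 1 / mu + 1 / (lam + mu)" using pos by simp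
    from mult_left_mono[OF this, of "2 * (B * Q)"] BQ show "2 * (B * Q) \<le> C" by (simp add: C_def mult_ac)
    have "1 \<le> (1 + 1 / mu + 1 / (lam + mu)) * mu" using pos by (simp add: distrib_right)
    from mult_left_mono[OF this, of "2 * (B * Q)"] BQ show "B * Q \<le> C * mu" by (simp add: C_def mult_ac)
    have "1 \<le> (1 + 1 / mu + 1 / (lam + mu)) * (lam + mu)"
    proof -
      have "1 / (lam + mu) * (lam + mu) \<le> (1 + 1 / mu + 1 / (lam + mu)) * (lam + mu)"
        using pos by (intro mult_right_mono) auto
      then show ?thesis using pos by simp
    qed
    from mult_left_mono[OF this, of "2 * (B * Q)"] BQ show "2 * (B * Q) \<le> C * (lam + mu)" by (simp add: C_def mult_ac)
  qed
  show ?thesis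
  proof (rule exI[of _ C], intro exI[of _ "1::real"] conjI allI impI)
    show "C > 0" using Cs(1) B Q by (smt (verit) mult_pos_pos)
    show "(1::real) > 0" by simp
    fix nx ny :: nat and xs ys :: "nat \<Rightarrow> real" and ux uy s11 s12 s22 fx fy :: "real \<Rightarrow> real \<Rightarrow> real"
      and Wx Wy Z11 Z22 Z12 :: "nat \<Rightarrow> nat \<Rightarrow> real"
    assume "is_grid a nx xs \<and> is_grid b ny ys \<and> regular_grid C0 nx xs ny ys
     \<and> hmax xs nx \<le> 1 \<and> hmax ys ny \<le> 1
     \<and> Ck 4 ux \<and> Ck 4 uy \<and> Ck 4 s11 \<and> Ck 4 s12 \<and> Ck 4 s22
     \<and> elasticity_solution a b lam mu ux uy s11 s12 s22 fx fy
     \<and> MACE_solution lam mu nx xs ny ys fx fy Wx Wy Z11 Z22 Z12"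
    then have grids: "is_grid a nx xs" "is_grid b ny ys"
      and smooth: "Ck 4 ux" "Ck 4 uy" "Ck 4 s11" "Ck 4 s12" "Ck 4 s22"
      and sol: "elasticity_solution a b lam mu ux uy s11 s12 s22 fx fy"
      and scheme: "MACE_solution lam mu nx xs ny ys fx fy Wx Wy Z11 Z22 Z12" by blast+
    define N where "N = max (norm3inf a b ux) (norm3inf a b uy)
            + max (norm3inf a b s11) (max (norm3inf a b s12) (norm3inf a b s22))"
    define H where "H = (hmax xs nx)\<^sup>2 + (hmax ys ny)\<^sup>2"
    define r where "r = N * H"
    have nx: "nx > 0" and ny: "ny > 0"
      using grid_card_pos[OF pos(1) grids(1)] grid_card_pos[OF pos(2) grids(2)] .
    have Ck3: "Ck 3 f" if "Ck 4 f" for f using Ck_mono[OF _ that, of 3] by simp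
    note nn = norm3inf_nonneg[OF Ck3 pos(1,2)]
    have N: "norm3inf a b ux \<le> N" "norm3inf a b uy \<le> N" "norm3inf a b s11 \<le> N" "norm3inf a b s12 \<le> N"
      "norm3inf a b s22 \<le> N" "N \<ge> 0"
      using nn[OF smooth(1)] nn[OF smooth(2)] nn[OF smooth(3)] nn[OF smooth(4)] nn[OF smooth(5)]
      unfolding N_def by linarith+
    have bd: "deriv_bound a b N ux" "deriv_bound a b N uy" "deriv_bound a b N s11" "deriv_bound a b N s12"
      "deriv_bound a b N s22"
      using deriv_bound_norm3inf[OF Ck3 pos(1,2)] smooth N by (blast intro: deriv_bound_mono)+
    note bdT = bd[THEN deriv_bound_transpose]
    have r0: "r \<ge> 0" using N by (simp add: r_def H_def)

    have pde: "compliance lam mu (s11 x y) (s22 x y) = pdx ux x y" "compliance lam mu (s22 x y) (s11 x y) = pdy uy x y"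
      "s12 x y = mu * (pdy ux x y + pdx uy x y)" "pdx s11 x y + pdy s12 x y = fx x y" "pdx s12 x y + pdy s22 x y = fy x y"
      if "0 < x" "x < a" "0 < y" "y < b" for x y
      using sol that unfolding elasticity_solution_def compliance_def by (auto simp: add.commute)
    have bc: "ux x y = 0" "uy x y = 0" if "0 \<le> x" "x \<le> a" "0 \<le> y" "y \<le> b" "x = 0 \<or> x = a \<or> y = 0 \<or> y = b" for x y
      using sol that unfolding elasticity_solution_def by auto
    have shear: "s12 x y = mu * (pdy ux x y + pdx uy x y)" if "0 \<le> x" "x \<le> a" "0 \<le> y" "y \<le> b" for x y
    proof (rule shear_closure[OF pos(1,2) _ _ _ pde(3) that])
      show "Ck 1 ux" "Ck 1 uy" "Ck 0 s12" by (rule Ck_mono[OF _ smooth(1)] Ck_mono[OF _ smooth(2)] Ck_mono[OF _ smooth(4)], simp)+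
    qed

    note sch = scheme[unfolded MACE_solution_def]
    note sch_bc = sch[THEN conjunct1, rule_format] sch[THEN conjunct2, THEN conjunct1, rule_format]
      sch[THEN conjunct2, THEN conjunct2, THEN conjunct1, rule_format]
      sch[THEN conjunct2, THEN conjunct2, THEN conjunct2, THEN conjunct1, rule_format]
    have sch_diag: "compliance lam mu (Z11 (2*i+1) (2*j+1)) (Z22 (2*i+1) (2*j+1)) = dX xs Wx i (2*j+1)"
      "compliance lam mu (Z22 (2*i+1) (2*j+1)) (Z11 (2*i+1) (2*j+1)) = dY ys Wy (2*i+1) j" if "i < nx" "j < ny" for i j
      using sch[THEN conjunct2, THEN conjunct2, THEN conjunct2, THEN conjunct2, THEN conjunct1, rule_format, OF that]
      unfolding compliance_def add.commute[of "Z22 (2*i+1) (2*j+1)" "Z11 (2*i+1) (2*j+1)"] by simp_all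
    note sch_off = sch[THEN conjunct2, THEN conjunct2, THEN conjunct2, THEN conjunct2, THEN conjunct2, THEN conjunct1, rule_format]
    note sch_x = sch[THEN conjunct2, THEN conjunct2, THEN conjunct2, THEN conjunct2, THEN conjunct2, THEN conjunct2, THEN conjunct1, rule_format]
    note sch_y = sch[THEN conjunct2, THEN conjunct2, THEN conjunct2, THEN conjunct2, THEN conjunct2, THEN conjunct2,
        THEN conjunct2, rule_format]

    define Ex where "Ex = (\<lambda>k m. Wx k m - dux xs ny ys ux k m)"
    define Ey where "Ey = (\<lambda>k m. Wy k m - duy nx xs ys uy k m)"
    define E11 where "E11 = (\<lambda>k m. Z11 k m - tsig_diag xs ys s11 k m)"
    define E22 where "E22 = (\<lambda>k m. Z22 k m - tsig_diag xs ys s22 k m)"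
    define E12 where "E12 = (\<lambda>k m. Z12 k m - tsig_off xs ys s12 k m)"

    have cx: "0 < coord xs (2*i+1)" "coord xs (2*i+1) < a" if "i < nx" for i
      using centre_interior[OF grids(1) that] by simp_all
    have cy: "0 < coord ys (2*j+1)" "coord ys (2*j+1) < b" if "j < ny" for j
      using centre_interior[OF grids(2) that] by simp_all
    have H': "(hmax ys ny)\<^sup>2 + (hmax xs nx)\<^sup>2 = H" by (simp add: H_def)

    have "normTM xs nx ys ny Ex \<le> B * (Q * r) \<and> normMT xs nx ys ny Ey \<le> B * (Q * r) \<and> normT xs nx ys ny E12 \<le> B * (Q * r)
      \<and> normM xs nx ys ny E11 \<le> B * (Q * r) \<and> normM xs nx ys ny E22 \<le> B * (Q * r)"
    proof (rule stab[rule_format, OF grids], safe)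
      show "0 \<le> Q * r" using Q r0 by simp
    next
      fix j assume j: "j < ny"
      note z = dux_boundary[OF pos(1) grids, of ux, OF _ _ j]
      show "Ex 0 (2*j+1) = 0" "Ex (2*nx) (2*j+1) = 0"
        unfolding Ex_def using sch_bc(1)[OF j] z bc(1) pos by simp_all
    next
      fix i assume i: "i \<le> nx"
      show "Ex (2*i) 0 = 0" "Ex (2*i) (2*ny) = 0"
        unfolding Ex_def using sch_bc(2)[OF i] by (simp_all add: dux_def)
    next
      fix i assume i: "i < nx"
      note z = dux_boundary[OF pos(2) grids(2,1), of "\<lambda>x y. uy y x", OF _ _ i]
      show "Ey (2*i+1) 0 = 0" "Ey (2*i+1) (2*ny) = 0"
        unfolding Ey_def duy_transpose using sch_bc(3)[OF i] z bc(2) pos by simp_all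
    next
      fix j assume j: "j \<le> ny"
      show "Ey 0 (2*j) = 0" "Ey (2*nx) (2*j) = 0"
        unfolding Ey_def using sch_bc(4)[OF j] by (simp_all add: duy_def)
    next
      fix i j assume i: "i < nx" and j: "j < ny"
      let ?X = "coord xs (2*i+1)" and ?Y = "coord ys (2*j+1)"
      have 1: "\<bar>tsig_diag xs ys s11 (2*i+1) (2*j+1) - s11 ?X ?Y\<bar> \<le> r" "\<bar>tsig_diag xs ys s22 (2*i+1) (2*j+1) - s22 ?X ?Y\<bar> \<le> r"
        using tsig_diag_error[OF grids bd(3) i j] tsig_diag_error[OF grids bd(5) i j] unfolding r_def H_def .
      have c: "\<bar>compliance lam mu p q\<bar> \<le> 1 / mu * r" if "\<bar>p\<bar> \<le> r" "\<bar>q\<bar> \<le> r" for p q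
      proof -
        have "(\<bar>p\<bar> + \<bar>q\<bar>) / (2 * mu) \<le> (2 * r) / (2 * mu)" using that pos by (intro divide_right_mono) auto
        then show ?thesis using abs_compliance_le[OF pos(3,4), of p q] by simp
      qed
      have Qr: "1 / mu * r + r \<le> Q * r" using mult_right_mono[OF Q(3) r0] by (simp add: distrib_right)
      \<comment> \<open>The scheme removes the discrete solution and the differential equation holds
        for the exact one, so only the truncation error of the strain and the compliance of the
        interpolation errors remain.\<close>
      have "compliance lam mu (E11 (2*i+1) (2*j+1)) (E22 (2*i+1) (2*j+1)) - dX xs Ex i (2*j+1)
          = (dX xs (tux xs ys ux) i (2*j+1) - pdx ux ?X ?Y)
            - compliance lam mu (tsig_diag xs ys s11 (2*i+1) (2*j+1) - s11 ?X ?Y) (tsig_diag xs ys s22 (2*i+1) (2*j+1) - s22 ?X ?Y)"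
        unfolding Ex_def E11_def E22_def compliance_diff dX_diff dX_dux sch_diag[OF i j]
          pde(1)[OF cx[OF i] cy[OF j]] by simp
      moreover have "\<bar>dX xs (tux xs ys ux) i (2*j+1) - pdx ux ?X ?Y\<bar> \<le> r"
        using dX_tux[OF grids bd(1) i j] unfolding r_def H_def .
      ultimately show "\<bar>compliance lam mu (E11 (2*i+1) (2*j+1)) (E22 (2*i+1) (2*j+1)) - dX xs Ex i (2*j+1)\<bar> \<le> Q * r"
        using c[OF 1] Qr by linarith
      have "compliance lam mu (E22 (2*i+1) (2*j+1)) (E11 (2*i+1) (2*j+1)) - dY ys Ey (2*i+1) j
          = (dX ys (tux ys xs (\<lambda>x y. uy y x)) j (2*i+1) - pdy uy ?X ?Y)
            - compliance lam mu (tsig_diag xs ys s22 (2*i+1) (2*j+1) - s22 ?X ?Y) (tsig_diag xs ys s11 (2*i+1) (2*j+1) - s11 ?X ?Y)"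
        unfolding Ey_def E11_def E22_def compliance_diff dY_diff sch_diag[OF i j]
          pde(2)[OF cx[OF i] cy[OF j]] duy_transpose dY_transpose[of ys "\<lambda>k m. dux ys nx xs (\<lambda>x y. uy y x) m k"] dX_dux by simp
      moreover have "\<bar>dX ys (tux ys xs (\<lambda>x y. uy y x)) j (2*i+1) - pdy uy ?X ?Y\<bar> \<le> r"
        using dX_tux[OF grids(2,1) bdT(2) j i] unfolding r_def H' pdx_transpose[of uy] .
      ultimately show "\<bar>compliance lam mu (E22 (2*i+1) (2*j+1)) (E11 (2*i+1) (2*j+1)) - dY ys Ey (2*i+1) j\<bar> \<le> Q * r"
        using c[OF 1(2,1)] Qr by linarith
    next
      fix i j assume i: "i \<le> nx" and j: "j \<le> ny"
      note xr = grid_range[OF grids(1) i] and yr = grid_range[OF grids(2) j]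
      have "\<bar>DY ys ny (dux xs ny ys ux) (2*i) j - pdy ux (xs i) (ys j)\<bar> \<le> r"
        using DY_tux[OF grids bd(1) i j ny] bc(1)[of "xs i" 0] bc(1)[of "xs i" b] xr pos
        unfolding r_def H_def dux_def[abs_def] by simp
      moreover have "\<bar>DX xs nx (duy nx xs ys uy) i (2*j) - pdx uy (xs i) (ys j)\<bar> \<le> r"
        using DY_tux[OF grids(2,1) bdT(2) j i nx] bc(2)[of 0 "ys j"] bc(2)[of a "ys j"] yr pos
        unfolding r_def H' pdy_transpose[of uy] DY_transpose[of xs nx] duy_transpose[abs_def] dux_def[abs_def] by simp
      moreover have "E12 (2*i) (2*j) / mu = DY ys ny Wx (2*i) j + DX xs nx Wy i (2*j)
          - (pdy ux (xs i) (ys j) + pdx uy (xs i) (ys j))"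
        unfolding E12_def sch_off[OF i j] tsig_off_def coord_even shear[OF xr yr]
        using pos by (simp add: diff_divide_distrib)
      moreover have "2 * r \<le> Q * r" using mult_right_mono[OF Q(2) r0] .
      ultimately show "\<bar>E12 (2*i) (2*j) / mu - (DY ys ny Ex (2*i) j + DX xs nx Ey i (2*j))\<bar> \<le> Q * r"
        unfolding Ex_def Ey_def DX_diff DY_diff by linarith
    next
      fix i j assume i: "i \<in> {1..<nx}" and j: "j < ny"
      then have i1: "1 \<le> i" "i < nx" "i \<le> nx" by auto
      let ?X = "xs i" and ?Y = "coord ys (2*j+1)"
      have X: "0 < ?X" "?X < a" using grid_interior[OF grids(1), of i] i1 by auto
      have "\<bar>DX xs nx (tsig_diag xs ys s11) i (2*j+1) - pdx s11 ?X ?Y\<bar> \<le> r"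
        using DX_tsig_diag[OF grids bd(3) i1(1,2) j] unfolding r_def H_def .
      moreover have "\<bar>dY ys (tsig_off xs ys s12) (2*i) j - pdy s12 ?X ?Y\<bar> \<le> r"
        using dY_tsig_off[OF grids bd(4) i1(3) j] unfolding r_def H_def .
      moreover have "2 * r \<le> Q * r" using mult_right_mono[OF Q(2) r0] .
      ultimately show "\<bar>DX xs nx E11 i (2*j+1) + dY ys E12 (2*i) j\<bar> \<le> Q * r"
        using sch_x[OF conjI[OF i1(1,2)] j] pde(4)[OF X cy[OF j]]
        unfolding E11_def E12_def DX_diff dY_diff by linarith
    next
      fix i j assume i: "i < nx" and j: "j \<in> {1..<ny}"
      then have j1: "1 \<le> j" "j < ny" "j \<le> ny" by auto
      let ?X = "coord xs (2*i+1)" and ?Y = "ys j"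
      have Y: "0 < ?Y" "?Y < b" using grid_interior[OF grids(2), of j] j1 by auto
      have "\<bar>DY ys ny (tsig_diag xs ys s22) (2*i+1) j - pdy s22 ?X ?Y\<bar> \<le> r"
        using DX_tsig_diag[OF grids(2,1) bdT(5) j1(1,2) i]
        unfolding r_def H' pdx_transpose[of s22] DY_transpose[of ys ny "tsig_diag xs ys s22"] tsig_diag_transpose[of xs ys s22] .
      moreover have "\<bar>dX xs (tsig_off xs ys s12) i (2*j) - pdx s12 ?X ?Y\<bar> \<le> r"
        using dY_tsig_off[OF grids(2,1) bdT(4) j1(3) i]
        unfolding r_def H' pdy_transpose[of s12] dY_transpose[of xs] tsig_off_transpose[of xs ys s12, abs_def] .
      moreover have "2 * r \<le> Q * r" using mult_right_mono[OF Q(2) r0] .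
      ultimately show "\<bar>dX xs E12 i (2*j) + DY ys ny E22 (2*i+1) j\<bar> \<le> Q * r"
        using sch_y[OF i conjI[OF j1(1,2)]] pde(5)[OF cx[OF i] Y]
        unfolding E22_def E12_def dX_diff DY_diff by linarith
    qed
    \<comment> \<open>The norm samples only odd second indices, while \<open>dux\<close> and
      \<open>tux\<close> differ only at the even indices 0 and \<open>2 * ny\<close>.\<close>
    moreover have "normTM xs nx ys ny Ex = normTM xs nx ys ny (\<lambda>k m. Wx k m - tux xs ys ux k m)"
      unfolding normTM_wsum Ex_def dux_def using odd_neq_even[of _ ny] by simp
    moreover have "normMT xs nx ys ny Ey = normMT xs nx ys ny (\<lambda>k m. Wy k m - tuy xs ys uy k m)"
      unfolding normMT_wsum Ey_def duy_def using odd_neq_even[of _ nx] by simp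
    ultimately have est:
      "normTM xs nx ys ny (\<lambda>k m. Wx k m - tux xs ys ux k m) \<le> (B * Q) * r"
      "normMT xs nx ys ny (\<lambda>k m. Wy k m - tuy xs ys uy k m) \<le> (B * Q) * r"
      "normT xs nx ys ny E12 \<le> (B * Q) * r" "normM xs nx ys ny E11 \<le> (B * Q) * r" "normM xs nx ys ny E22 \<le> (B * Q) * r"
      by (simp_all add: mult.assoc)
    have scale: "k * r \<le> k' * ((hmax xs nx)\<^sup>2 + (hmax ys ny)\<^sup>2) * N" if "k \<le> k'" for k k'
      using mult_right_mono[OF that r0] by (simp add: r_def H_def mult_ac)
    show "let h = hmax xs nx; l = hmax ys ny;
          N = max (norm3inf a b ux) (norm3inf a b uy)
            + max (norm3inf a b s11) (max (norm3inf a b s12) (norm3inf a b s22))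
      in normTM xs nx ys ny (\<lambda>k m. Wx k m - tux xs ys ux k m)
           + normMT xs nx ys ny (\<lambda>k m. Wy k m - tuy xs ys uy k m)
           \<le> C * (h\<^sup>2 + l\<^sup>2) * N
       \<and> normT xs nx ys ny (\<lambda>k m. Z12 k m - tsig_off xs ys s12 k m)
           \<le> C * mu * (h\<^sup>2 + l\<^sup>2) * N
       \<and> normM xs nx ys ny (\<lambda>k m. Z11 k m - tsig_diag xs ys s11 k m)
           + normM xs nx ys ny (\<lambda>k m. Z22 k m - tsig_diag xs ys s22 k m)
           \<le> C * (lam + mu) * (h\<^sup>2 + l\<^sup>2) * N"
      unfolding Let_def N_def[symmetric]
      using est scale[OF Cs(1)] scale[OF Cs(2)] scale[OF Cs(3)]
      unfolding E12_def E11_def E22_def by (intro conjI; linarith)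
  qed
qed

end
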